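(* Let $d\ge 3$ be an integer, $e\in K$ a primitive $d$-th root of $1$, and let $a,b,c$ be integers with $0\le a\le b\le c\le d-1$ and $\gcd(a,b,c,d)=1$. Let $I\subset K[x,y,z]$ be the ideal generated by all monomials of degree $d$ invariant under the action of $M_{a,b,c}=\begin{pmatrix}e^a&0&0\\0&e^b&0\\0&0&e^c\end{pmatrix}$. If $\mu(I)\le d+1$, then $I$ is a GT-system; that is, $I$ fails the Weak Lefschetz Property from degree $d-1$ to degree $d$.
   Context: $K$ is an algebraically closed field of characteristic zero and $R=K[x,y,z]$. The matrix $M_{a,b,c}$ acts on $R$ by $x\mapsto e^a x$, $y\mapsto e^b y$, $z\mapsto e^c z$. $\mu(I)$ is the minimal number of generators of $I$. "$I$ fails the Weak Lefschetz Property from degree $d-1$ to degree $d$" means that for every linear form $L\in R_1$ the multiplication map $\times L:(R/I)_{d-1}\to (R/I)_d$ does not have maximal rank. A homogeneous artinian ideal generated by forms of degree $d$ with $\mu(I)\le d+1$ having this failure is a Togliatti system. A GT-system is a Togliatti system generated by forms of degree $d$, namely by all forms of degree $d$ invariant under some matrix $M_{a,b,c}$ as in the claim, whose associated morphism $\varphi_I:\mathbb{P}^2\to\mathbb{P}^{\mu(I)-1}$ (given by a minimal set of generators) is a Galois covering of its image with cyclic Galois group $\mathbb{Z}/d\mathbb{Z}$. *)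

theory Defs
  imports
    "HOL-Library.Poly_Mapping"
    "HOL-Library.Numeral_Type"
    "HOL-Library.Set_Algebras"
    "HOL-Computational_Algebra.Polynomial"
    "HOL-Computational_Algebra.Fraction_Field"
    "HOL-Algebra.Bij"
    "HOL-Algebra.Elementary_Groups"
begin

section \<open>Polynomials\<close>

text \<open>
  The polynomial ring over \<open>'k\<close> with variables indexed by \<open>'v\<close> is the monoid algebra of the
  exponent vectors \<open>'v \<Rightarrow>\<^sub>0 nat\<close>.  For \<open>K[x,y,z]\<close> the index type is \<open>3\<close>, whose elements
  \<open>1\<close>, \<open>2\<close>, \<open>3\<close> stand for \<open>x\<close>, \<open>y\<close>, \<open>z\<close> (as an element of the type \<open>3\<close>, \<open>3\<close> equals \<open>0\<close>).
\<close>

type_synonym ('v, 'k) mpol = "('v \<Rightarrow>\<^sub>0 nat) \<Rightarrow>\<^sub>0 'k"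
type_synonym 'k pol3 = "(3, 'k) mpol"

definition triple :: "'a \<Rightarrow> 'a \<Rightarrow> 'a \<Rightarrow> 3 \<Rightarrow> 'a" where
  "triple p q r = (\<lambda>i. if i = 1 then p else if i = 2 then q else r)"

definition Const :: "'k \<Rightarrow> ('v, 'k::zero) mpol" where
  "Const c = Poly_Mapping.single 0 c"

definition Var :: "'v \<Rightarrow> ('v, 'k::zero_neq_one) mpol" where
  "Var i = Poly_Mapping.single (Poly_Mapping.single i 1) 1"

definition monomial :: "('v \<Rightarrow>\<^sub>0 nat) \<Rightarrow> ('v, 'k::zero_neq_one) mpol" where
  "monomial m = Poly_Mapping.single m 1"

definition mdeg :: "('v \<Rightarrow>\<^sub>0 nat) \<Rightarrow> nat" where
  "mdeg m = (\<Sum>i\<in>Poly_Mapping.keys m. Poly_Mapping.lookup m i)"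

text \<open>The homogeneous component of degree \<open>n\<close>; it contains \<open>0\<close>.\<close>

definition forms :: "nat \<Rightarrow> ('v, 'k::zero) mpol set" where
  "forms n = {P. \<forall>m\<in>Poly_Mapping.keys P. mdeg m = n}"

text \<open>
  Substitution of \<open>u i\<close> for the \<open>i\<close>-th variable, where \<open>h\<close> maps the coefficients to the
  target ring.
\<close>

definition subst :: "('k::zero \<Rightarrow> 'r::comm_ring_1) \<Rightarrow> ('v \<Rightarrow> 'r) \<Rightarrow> ('v, 'k) mpol \<Rightarrow> 'r" where
  "subst h u P = (\<Sum>m\<in>Poly_Mapping.keys P. h (Poly_Mapping.lookup P m) *
     (\<Prod>i\<in>Poly_Mapping.keys m. u i ^ Poly_Mapping.lookup m i))"

abbreviation evaluate :: "('v \<Rightarrow> 'k::comm_ring_1) \<Rightarrow> ('v, 'k) mpol \<Rightarrow> 'k" where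
  "evaluate \<equiv> subst (\<lambda>c. c)"

section \<open>Ideals\<close>

definition is_ideal :: "'r::comm_ring_1 set \<Rightarrow> bool" where
  "is_ideal I \<longleftrightarrow> module.subspace (*) I"

definition ideal_of :: "'r::comm_ring_1 set \<Rightarrow> 'r set" where
  "ideal_of S = module.span (*) S"

text \<open>The number \<open>\<mu>(I)\<close>.\<close>

definition min_gens :: "'r::comm_ring_1 set \<Rightarrow> nat" where
  "min_gens I = (LEAST n. \<exists>S. finite S \<and> card S = n \<and> ideal_of S = I)"

text \<open>
  The quotient ring by \<open>I\<close> is artinian; its ideals correspond to the ideals containing \<open>I\<close>.
\<close>

definition artinian_ideal :: "'r::comm_ring_1 set \<Rightarrow> bool" where
  "artinian_ideal I \<longleftrightarrow> is_ideal I \<and>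
     (\<forall>J :: nat \<Rightarrow> 'r set. (\<forall>n. is_ideal (J n) \<and> I \<subseteq> J n \<and> J (Suc n) \<subseteq> J n) \<longrightarrow>
       (\<exists>N. \<forall>n\<ge>N. J n = J N))"

section \<open>The Weak Lefschetz Property\<close>

text \<open>The component \<open>(R/I)\<^sub>n\<close>, a set of cosets \<open>f + I\<close>.\<close>

definition quot_piece :: "'k::comm_ring_1 pol3 set \<Rightarrow> nat \<Rightarrow> 'k pol3 set set" where
  "quot_piece I n = (\<lambda>f. f +o I) ` forms n"

text \<open>The map \<open>f + I \<mapsto> L f + I\<close>.\<close>

definition mult_map :: "'k::comm_ring_1 pol3 set \<Rightarrow> 'k pol3 \<Rightarrow> 'k pol3 set \<Rightarrow> 'k pol3 set" where
  "mult_map I L X = (\<Union>f\<in>X. (L * f) +o I)"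

definition maximal_rank :: "'k::comm_ring_1 pol3 set \<Rightarrow> 'k pol3 \<Rightarrow> nat \<Rightarrow> bool" where
  "maximal_rank I L n \<longleftrightarrow>
     inj_on (mult_map I L) (quot_piece I n) \<or>
     mult_map I L ` quot_piece I n = quot_piece I (Suc n)"

text \<open>Failure from degree \<open>n\<close> to degree \<open>n + 1\<close>.\<close>

definition fails_WLP_from :: "'k::comm_ring_1 pol3 set \<Rightarrow> nat \<Rightarrow> bool" where
  "fails_WLP_from I n \<longleftrightarrow> (\<forall>L\<in>forms 1. \<not> maximal_rank I L n)"

definition togliatti_system :: "nat \<Rightarrow> 'k::comm_ring_1 pol3 set \<Rightarrow> bool" where
  "togliatti_system d I \<longleftrightarrow>
     artinian_ideal I \<and>
     (\<exists>S \<subseteq> forms d. I = ideal_of S) \<and>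
     min_gens I \<le> d + 1 \<and>
     fails_WLP_from I (d - 1)"

section \<open>Diagonal actions\<close>

definition primitive_root_of_1 :: "nat \<Rightarrow> 'k::field \<Rightarrow> bool" where
  "primitive_root_of_1 d e \<longleftrightarrow> d > 0 \<and> e ^ d = 1 \<and> (\<forall>k. 0 < k \<and> k < d \<longrightarrow> e ^ k \<noteq> 1)"

definition act :: "'k::field \<Rightarrow> nat \<Rightarrow> nat \<Rightarrow> nat \<Rightarrow> 'k pol3 \<Rightarrow> 'k pol3" where
  "act e a b c =
     subst Const (triple (Const (e ^ a) * Var 1) (Const (e ^ b) * Var 2) (Const (e ^ c) * Var 3))"

definition admissible :: "nat \<Rightarrow> 'k::field \<Rightarrow> nat \<Rightarrow> nat \<Rightarrow> nat \<Rightarrow> bool" where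
  "admissible d e a b c \<longleftrightarrow>
     d \<ge> 3 \<and> primitive_root_of_1 d e \<and> a \<le> b \<and> b \<le> c \<and> c \<le> d - 1 \<and> Gcd {a, b, c, d} = 1"

definition invariant_monomials ::
    "nat \<Rightarrow> 'k::field \<Rightarrow> nat \<Rightarrow> nat \<Rightarrow> nat \<Rightarrow> 'k pol3 set" where
  "invariant_monomials d e a b c =
     {monomial m | m. mdeg m = d \<and> act e a b c (monomial m) = monomial m}"

definition invariant_forms ::
    "nat \<Rightarrow> 'k::field \<Rightarrow> nat \<Rightarrow> nat \<Rightarrow> nat \<Rightarrow> 'k pol3 set" where
  "invariant_forms d e a b c = {f \<in> forms d. act e a b c f = f}"

section \<open>Projective spaces and their morphisms\<close>

text \<open>
  A point of a projective space is the set of its vectors of homogeneous coordinates.  The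
  coordinates are indexed by \<open>'v\<close>; those outside \<open>V\<close> vanish, so that
  \<open>proj_space {..<n} :: (nat \<Rightarrow> 'k) set set\<close> is the projective space of dimension \<open>n - 1\<close>.
\<close>

definition proj_pt :: "('v \<Rightarrow> 'k::field) \<Rightarrow> ('v \<Rightarrow> 'k) set" where
  "proj_pt u = {(\<lambda>i. t * u i) | t. t \<noteq> 0}"

definition proj_space :: "'v set \<Rightarrow> ('v \<Rightarrow> 'k::field) set set" where
  "proj_space V = {proj_pt u | u. u \<noteq> (\<lambda>_. 0) \<and> (\<forall>i. i \<notin> V \<longrightarrow> u i = 0)}"

abbreviation P2 :: "(3 \<Rightarrow> 'k::field) set set" where
  "P2 \<equiv> proj_space UNIV"

definition regular_P2 :: "((3 \<Rightarrow> 'k::field) set \<Rightarrow> (3 \<Rightarrow> 'k) set) \<Rightarrow> bool" where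
  "regular_P2 \<sigma> \<longleftrightarrow>
     \<sigma> \<in> P2 \<rightarrow> P2 \<and>
     (\<forall>p\<in>P2. \<exists>n (H :: 3 \<Rightarrow> 'k pol3). (\<forall>i. H i \<in> forms n) \<and>
        (\<forall>u\<in>p. \<exists>i. evaluate u (H i) \<noteq> 0) \<and>
        (\<forall>u. (\<exists>i. evaluate u (H i) \<noteq> 0) \<and> proj_pt u \<in> P2 \<longrightarrow>
           \<sigma> (proj_pt u) = proj_pt (\<lambda>i. evaluate u (H i))))"

definition auts_P2 :: "((3 \<Rightarrow> 'k::field) set \<Rightarrow> (3 \<Rightarrow> 'k) set) set" where
  "auts_P2 = {\<sigma> \<in> Bij P2. regular_P2 \<sigma> \<and> regular_P2 (restrict (inv_into P2 \<sigma>) P2)}"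

text \<open>
  The values of the forms \<open>Fs\<close> at \<open>u\<close>, and the map to the projective space of dimension
  \<open>length Fs - 1\<close> induced by them.  The union below is over equal sets if the forms have the
  same degree.
\<close>

definition values_at :: "'k::field pol3 list \<Rightarrow> (3 \<Rightarrow> 'k) \<Rightarrow> nat \<Rightarrow> 'k" where
  "values_at Fs u = (\<lambda>j. if j < length Fs then evaluate u (Fs ! j) else 0)"

definition phi :: "'k::field pol3 list \<Rightarrow> (3 \<Rightarrow> 'k) set \<Rightarrow> (nat \<Rightarrow> 'k) set" where
  "phi Fs p = (\<Union>u\<in>p. proj_pt (values_at Fs u))"

text \<open>
  The standard affine charts of the target cover the image.  Over the chart where the
  coordinate of \<open>F \<in> Fs\<close> does not vanish, the coordinate ring of the preimage is the degree-zero
  part of the localization at \<open>F\<close>, and the coordinate ring of the (closed) image is the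
  subalgebra generated by the quotients \<open>Fs ! j / F\<close>.  All these rings lie in the field of
  fractions of the polynomial ring.
\<close>

definition preimage_chart_ring :: "nat \<Rightarrow> 'k::field pol3 \<Rightarrow> 'k pol3 fract set" where
  "preimage_chart_ring d F = {Fract P (F ^ n) | P n. P \<in> forms (n * d)}"

definition image_chart_ring :: "'k::field pol3 list \<Rightarrow> 'k pol3 \<Rightarrow> 'k pol3 fract set" where
  "image_chart_ring Fs F =
     range (subst (\<lambda>t. Fract (Const t) 1) (\<lambda>j::nat. if j < length Fs then Fract (Fs ! j) F else 0))"

definition finite_over :: "'r::comm_ring_1 set \<Rightarrow> 'r set \<Rightarrow> bool" where
  "finite_over B A \<longleftrightarrow>
     (\<exists>S \<subseteq> B. finite S \<and> (\<forall>x\<in>B. \<exists>r. (\<forall>s\<in>S. r s \<in> A) \<and> x = (\<Sum>s\<in>S. r s * s)))"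

text \<open>
  \<open>phi Fs\<close> is an everywhere defined morphism, and it is finite onto its image.
\<close>

definition is_covering :: "nat \<Rightarrow> 'k::field pol3 list \<Rightarrow> bool" where
  "is_covering d Fs \<longleftrightarrow>
     set Fs \<subseteq> forms d \<and>
     phi Fs \<in> P2 \<rightarrow> proj_space {..<length Fs} \<and>
     (\<forall>F\<in>set Fs. F \<noteq> 0 \<longrightarrow> finite_over (preimage_chart_ring d F) (image_chart_ring Fs F))"

definition deck_group ::
    "'k::field pol3 list \<Rightarrow> ((3 \<Rightarrow> 'k) set \<Rightarrow> (3 \<Rightarrow> 'k) set) monoid" where
  "deck_group Fs =
     BijGroup P2 \<lparr>carrier := {\<sigma> \<in> auts_P2. \<forall>p\<in>P2. phi Fs (\<sigma> p) = phi Fs p}\<rparr>"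

definition galois_covering :: "nat \<Rightarrow> 'k::field pol3 list \<Rightarrow> bool" where
  "galois_covering d Fs \<longleftrightarrow>
     is_covering d Fs \<and>
     (\<forall>p\<in>P2. \<forall>q\<in>P2. phi Fs p = phi Fs q \<longrightarrow> (\<exists>\<sigma>\<in>carrier (deck_group Fs). \<sigma> p = q))"

section \<open>GT-systems\<close>

text \<open>
  Two minimal lists of generating forms of degree \<open>d\<close> give morphisms that differ by a linear
  change of coordinates of the target, so the last condition does not depend on the list.
\<close>

definition GT_system :: "nat \<Rightarrow> 'k::field pol3 set \<Rightarrow> bool" where
  "GT_system d I \<longleftrightarrow>
     togliatti_system d I \<and>
     (\<exists>e a b c. admissible d e a b c \<and> I = ideal_of (invariant_forms d e a b c)) \<and>
     (\<forall>Fs. set Fs \<subseteq> forms d \<and> length Fs = min_gens I \<and> ideal_of (set Fs) = I \<longrightarrow>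
        galois_covering d Fs \<and> deck_group Fs \<cong> integer_mod_group d)"

end

theory Submission
  imports Defs
begin

text \<open>
  For a linear form \<open>L\<close>, the product of \<open>L\<close> with its nontrivial translates under powers of the
  matrix \<open>M\<close> is an invariant form of degree \<open>d\<close>, hence lies in \<open>I\<close>; so multiplication by
  \<open>L\<close> is not injective, and since \<open>\<mu>(I) \<le> d + 1\<close> is the dimension of \<open>I\<close> in degree \<open>d\<close>, it is
  not surjective either.  The same norms separate the orbits of \<open>M\<close>, so the fibres of the
  morphism are exactly these orbits.  A deck transformation maps each point to a translate by
  a power of \<open>M\<close>; as the plane is irreducible, the same power works at every point.

  The group generated by \<open>M\<close> in the projective linear group has order \<open>d\<close> unless
  \<open>g = gcd(b - a, c - a, d)\<close> exceeds 1, which the hypothesis \<open>gcd(a, b, c, d) = 1\<close> allows.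
  In that case a lattice point count shows that there are more than \<open>d + 1\<close> invariant monomials.
\<close>

section \<open>Polynomials\<close>

text \<open>The bound \<open>d + 1\<close> is the difference of the dimensions of the polynomial
  ring in degrees \<open>d\<close> and \<open>d - 1\<close>. As \<open>I\<close> starts in degree
  \<open>d\<close>, the source of the multiplication map is the full space of forms of degree
  \<open>d - 1\<close>, and its target is at least as large, so a nonzero kernel already excludes
  surjectivity. The pure powers x^d, y^d, z^d are invariant whatever the weights are. They bound the
  exponents modulo \<open>I\<close>, exclude base points of the morphism and make the chart rings
  finite. Density arguments on the plane all take one form: a product of finitely many nonzero
  polynomials is nonzero, and in characteristic zero there is a point where none of its factors
  vanishes. \<open>min_gens\<close> allows inhomogeneous generators, so comparing it with a
  dimension goes through their components of lowest degree. The degenerate case does occur: for a =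
  b = c = 1 the matrix is scalar, fixes every point of the plane and leaves every form of degree
  \<open>d\<close> invariant.\<close>

abbreviation (input) lookup where "lookup \<equiv> Poly_Mapping.lookup"
abbreviation (input) keys where "keys \<equiv> Poly_Mapping.keys"
abbreviation (input) single where "single \<equiv> Poly_Mapping.single"

definition mon :: "('v \<Rightarrow> 'r::comm_ring_1) \<Rightarrow> ('v \<Rightarrow>\<^sub>0 nat) \<Rightarrow> 'r" where
  "mon u m = (\<Prod>i\<in>keys m. u i ^ lookup m i)"

lemma UNIV_three: "(UNIV :: 3 set) = {1, 2, 3}"
proof (rule sym, rule card_subset_eq)
  show "card {1, 2, 3 :: 3} = card (UNIV :: 3 set)"
    by simp
qed auto

lemma exhaust_three: "i = 1 \<or> i = 2 \<or> i = (3 :: 3)"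
  using UNIV_three by auto

lemma three_superset: "A \<subseteq> {1, 2, 3 :: 3}"
  using exhaust_three by blast

lemma mon_superset:
  assumes "finite A" "keys m \<subseteq> A"
  shows "mon u m = (\<Prod>i\<in>A. u i ^ lookup m i)"
  unfolding mon_def using assms
  by (intro prod.mono_neutral_left) (auto simp: in_keys_iff)

lemma mon_0 [simp]: "mon u 0 = 1"
  by (simp add: mon_def)

lemma mon_add: "mon u (m + n) = mon u m * mon u n"
proof -
  let ?A = "keys m \<union> keys n"
  have "mon u (m + n) = (\<Prod>i\<in>?A. u i ^ lookup (m + n) i)"
    using keys_add[of m n] by (intro mon_superset) auto
  also have "\<dots> = (\<Prod>i\<in>?A. u i ^ lookup m i) * (\<Prod>i\<in>?A. u i ^ lookup n i)"
    by (simp add: lookup_add power_add prod.distrib)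
  also have "\<dots> = mon u m * mon u n"
    by (simp add: mon_superset[of ?A])
  finally show ?thesis .
qed

lemma mon_single: "mon u (single i n) = u i ^ n"
  by (simp add: mon_def)

lemma mon_mult: "mon (\<lambda>i. u i * v i) m = mon u m * mon v m"
  by (simp add: mon_def power_mult_distrib prod.distrib)

lemma mon_const: "mon (\<lambda>_. t) m = t ^ mdeg m"
  by (simp add: mon_def mdeg_def power_sum)

lemma mon_3: "mon u (m :: 3 \<Rightarrow>\<^sub>0 nat) = u 1 ^ lookup m 1 * u 2 ^ lookup m 2 * u 3 ^ lookup m 3"
  using mon_superset[OF _ three_superset[of "keys m"], of u] by (simp add: mult.assoc)

lemma mdeg_superset: "finite A \<Longrightarrow> keys m \<subseteq> A \<Longrightarrow> mdeg m = (\<Sum>i\<in>A. lookup m i)"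
  unfolding mdeg_def by (intro sum.mono_neutral_left) (auto simp: in_keys_iff)

lemma mdeg_0 [simp]: "mdeg 0 = 0"
  by (simp add: mdeg_def)

lemma mdeg_add: "mdeg (m + n) = mdeg m + mdeg n"
proof -
  have "mdeg (m + n) = (\<Sum>i\<in>keys m \<union> keys n. lookup (m + n) i)"
    using keys_add[of m n] by (intro mdeg_superset) auto
  also have "\<dots> = mdeg m + mdeg n"
    by (simp add: lookup_add sum.distrib mdeg_superset[of "keys m \<union> keys n"])
  finally show ?thesis .
qed

lemma mdeg_single [simp]: "mdeg (single i n) = n"
  by (simp add: mdeg_def)

lemma expvec_eqI:
  assumes "lookup m 1 = lookup n 1" "lookup m 2 = lookup n 2" "lookup m 3 = lookup n 3"
  shows "(m :: 3 \<Rightarrow>\<^sub>0 nat) = n"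
proof (rule poly_mapping_eqI)
  show "lookup m k = lookup n k" for k
    using exhaust_three[of k] assms by auto
qed

lemma sum_single_lookup: "(\<Sum>m\<in>keys P. single m (lookup P m)) = P"
  by (rule poly_mapping_eqI)
    (auto simp: lookup_sum lookup_single when_def sum.delta' in_keys_iff)

lemma Const_simps [simp]:
  "Const 0 = (0 :: ('v, 'k::comm_ring_1) mpol)" "Const 1 = (1 :: ('v, 'k::comm_ring_1) mpol)"
  by (simp_all add: Const_def)

lemma Const_add: "Const (a + b) = Const a + (Const b :: ('v, 'k::comm_ring_1) mpol)"
  by (simp add: Const_def single_add)

lemma Const_mult: "Const (a * b) = Const a * (Const b :: ('v, 'k::comm_ring_1) mpol)"
  by (simp add: Const_def mult_single)

lemma Const_power: "Const (a ^ n) = (Const a :: ('v, 'k::comm_ring_1) mpol) ^ n"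
  by (induction n) (simp_all add: Const_mult)

lemma lookup_Const_mult: "lookup (Const c * P) m = c * lookup P m"
  for P :: "('v, 'k::comm_ring_1) mpol"
  unfolding Const_def mult_map_scale_conv_mult[symmetric]
  by (simp add: Poly_Mapping.map.rep_eq when_def)

lemma Const_mult_single: "Const c * single m x = single m (c * x)"
  for c :: "'k::comm_ring_1"
  by (simp add: Const_def mult_single)

section \<open>Substitution as a ring homomorphism\<close>

locale coeff_hom =
  fixes h :: "'k::comm_ring_1 \<Rightarrow> 'r::comm_ring_1"
  assumes h_0: "h 0 = 0" and h_1: "h 1 = 1"
    and h_add: "h (x + y) = h x + h y" and h_mult: "h (x * y) = h x * h y"
begin

lemma subst_mon: "subst h u P = (\<Sum>m\<in>keys P. h (lookup P m) * mon u m)"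
  by (simp add: subst_def mon_def)

lemma subst_single: "subst h u (single m x) = h x * mon u m"
  by (simp add: subst_mon h_0)

lemma subst_0 [simp]: "subst h u 0 = 0"
  by (simp add: subst_def)

lemma subst_1 [simp]: "subst h u 1 = 1"
  using subst_single[of u 0 1] by (simp add: h_1)

lemma subst_add: "subst h u (P + Q) = subst h u P + subst h u Q"
  unfolding subst_mon
  by (rule setsum_keys_plus_distrib) (auto simp: h_0 h_add algebra_simps)

lemma subst_sum: "subst h u (\<Sum>x\<in>A. f x) = (\<Sum>x\<in>A. subst h u (f x))"
  by (induction A rule: infinite_finite_induct) (simp_all add: subst_add)

lemma subst_mult: "subst h u (P * Q) = subst h u P * subst h u Q"
proof -
  have "P * Q = (\<Sum>m\<in>keys P. \<Sum>n\<in>keys Q. single (m + n) (lookup P m * lookup Q n))"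
    by (subst (1 2) sum_single_lookup[symmetric]) (simp add: sum_product mult_single)
  then have "subst h u (P * Q) =
      (\<Sum>m\<in>keys P. \<Sum>n\<in>keys Q. (h (lookup P m) * mon u m) * (h (lookup Q n) * mon u n))"
    by (simp add: subst_sum subst_single h_mult mon_add mult_ac)
  also have "\<dots> = subst h u P * subst h u Q"
    by (simp add: subst_mon sum_product)
  finally show ?thesis .
qed

lemma subst_prod: "subst h u (\<Prod>x\<in>A. f x) = (\<Prod>x\<in>A. subst h u (f x))"
  by (induction A rule: infinite_finite_induct) (simp_all add: subst_mult)

lemma subst_Const: "subst h u (Const x) = h x"
  by (simp add: Const_def subst_single)

lemma subst_Var: "subst h u (Var i) = u i"
  by (simp add: Var_def subst_single mon_single h_1)

end

interpretation evaluate: coeff_hom "\<lambda>c. c :: 'k::comm_ring_1"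
  by unfold_locales simp_all

interpretation subst_Const: coeff_hom "Const :: 'k::comm_ring_1 \<Rightarrow> ('v, 'k) mpol"
  by unfold_locales (simp_all add: Const_add Const_mult)

section \<open>Homogeneous forms\<close>

lemma forms_0 [simp]: "0 \<in> forms n"
  by (simp add: forms_def)

lemma forms_iff: "P \<in> forms n \<longleftrightarrow> (\<forall>m. lookup P m \<noteq> 0 \<longrightarrow> mdeg m = n)"
  by (auto simp: forms_def in_keys_iff)

lemma forms_add: "P \<in> forms n \<Longrightarrow> Q \<in> forms n \<Longrightarrow> P + Q \<in> forms n"
  for P Q :: "('v, 'k::comm_ring_1) mpol"
  by (auto simp: forms_iff lookup_add) (metis add_0)

lemma forms_diff: "P \<in> forms n \<Longrightarrow> Q \<in> forms n \<Longrightarrow> P - Q \<in> forms n"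
  for P Q :: "('v, 'k::comm_ring_1) mpol"
  by (auto simp: forms_iff lookup_minus) (metis diff_0_right)

lemma forms_mult: "P \<in> forms n \<Longrightarrow> Q \<in> forms k \<Longrightarrow> P * Q \<in> forms (n + k)"
  for P Q :: "('v, 'k::comm_ring_1) mpol"
  using keys_mult[of P Q] by (fastforce simp: forms_def mdeg_add)

lemma forms_1 [simp]: "(1 :: ('v, 'k::comm_ring_1) mpol) \<in> forms 0"
  by (auto simp: forms_def)

lemma forms_prod: "finite A \<Longrightarrow> (\<And>x. x \<in> A \<Longrightarrow> f x \<in> forms n) \<Longrightarrow> (\<Prod>x\<in>A. f x) \<in> forms (card A * n)"
  for f :: "_ \<Rightarrow> ('v, 'k::comm_ring_1) mpol"
  by (induction A rule: finite_induct) (auto intro: forms_mult)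

lemma forms_single [simp]: "single m c \<in> forms n \<longleftrightarrow> c = 0 \<or> mdeg m = n"
  by (auto simp: forms_def)

lemma forms_Const: "Const c \<in> forms 0"
  by (simp add: Const_def)

lemma forms_Const_mult: "P \<in> forms n \<Longrightarrow> Const c * P \<in> forms n"
  for P :: "('v, 'k::comm_ring_1) mpol"
  using forms_mult[OF forms_Const[of c], of P n] by simp

lemma forms_Var: "(Var i :: ('v, 'k::comm_ring_1) mpol) \<in> forms 1"
  by (simp add: Var_def)

lemma evaluate_scaled:
  assumes "P \<in> forms n"
  shows "evaluate (\<lambda>i. t * u i) P = t ^ n * evaluate u P"
proof -
  have "evaluate (\<lambda>i. t * u i) P = (\<Sum>m\<in>keys P. lookup P m * (t ^ n * mon u m))"
    unfolding evaluate.subst_mon using assms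
    by (intro sum.cong) (auto simp: mon_mult mon_const forms_def)
  then show ?thesis
    by (simp add: evaluate.subst_mon sum_distrib_left mult_ac)
qed

lemma inj_monomial: "inj (monomial :: _ \<Rightarrow> ('v, 'k::comm_ring_1) mpol)"
proof (rule injI)
  fix m n :: "'v \<Rightarrow>\<^sub>0 nat"
  assume "monomial m = (monomial n :: ('v, 'k) mpol)"
  then have "keys (single m (1::'k)) = keys (single n (1::'k))" 
    by (simp add: monomial_def)
  then show "m = n" by simp
qed

lemma lookup_monomial: "lookup (monomial m) n = (if n = m then 1 else 0)"
  by (auto simp: monomial_def lookup_single when_def)

lemma nonvanishing_point:
  fixes P :: "'k::field_char_0 pol3"
  assumes "P \<noteq> 0"
  obtains u where "evaluate u P \<noteq> 0"
proof -
  text \<open>The Kronecker substitution \<open>x, y, z \<mapsto> t, t\<^sup>B, t\<^sup>B\<^sup>2\<close> with \<open>B\<close> above all exponents keeps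
    distinct monomials distinct.\<close>
  define B where "B = Suc (Max (\<Union>m\<in>keys P. lookup m ` UNIV))"
  define code where "code m = lookup m 1 + B * (lookup m 2 + B * lookup m 3)"
    for m :: "3 \<Rightarrow>\<^sub>0 nat"
  have less: "lookup m i < B" if "m \<in> keys P" for m i
    using that unfolding B_def less_Suc_eq_le by (intro Max_ge) auto
  have inj: "m = n" if "m \<in> keys P" "n \<in> keys P" "code m = code n" for m n
  proof (rule expvec_eqI)
    have digits: "code q mod B = lookup q 1" "code q div B mod B = lookup q 2"
      "code q div B div B = lookup q 3" if "q \<in> keys P" for q
      using less[OF that, of 1] less[OF that, of 2] by (simp_all add: code_def)
    show "lookup m 1 = lookup n 1" "lookup m 2 = lookup n 2" "lookup m 3 = lookup n 3"
      using digits[OF that(1)] digits[OF that(2)] that(3) by metis+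
  qed
  define p where "p = (\<Sum>m\<in>keys P. monom (lookup P m) (code m))"
  obtain m where m: "m \<in> keys P"
    using assms by (metis keys_eq_empty ex_in_conv)
  have "coeff p (code m) = (\<Sum>n\<in>keys P. if n = m then lookup P n else 0)"
    unfolding p_def coeff_sum
  proof (rule sum.cong)
    fix n assume n: "n \<in> keys P"
    have "code n = code m \<longleftrightarrow> n = m"
      using inj[OF n m] by blast
    then show "coeff (monom (lookup P n) (code n)) (code m) = (if n = m then lookup P n else 0)"
      by simp
  qed simp
  also have "\<dots> \<noteq> 0"
    using m by (simp add: in_keys_iff)
  finally have "p \<noteq> 0" by auto
  then have "finite {t. poly p t = 0}"
    by (rule poly_roots_finite)
  then obtain t where t: "poly p t \<noteq> 0"
    using infinite_UNIV_char_0[where ?'a = 'k] by (metis (mono_tags, lifting) UNIV_I finite_subset mem_Collect_eq subsetI)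
  have "evaluate (triple t (t ^ B) (t ^ (B * B))) P = poly p t"
    unfolding evaluate.subst_mon p_def poly_sum
    by (intro sum.cong)
      (simp_all add: poly_monom mon_3 triple_def code_def power_mult[symmetric] power_add distrib_left mult_ac)
  with t that show thesis by metis
qed

section \<open>Ideals and graded pieces\<close>

lemma ring_module: "module ((*) :: 'r::comm_ring_1 \<Rightarrow> 'r \<Rightarrow> 'r)"
  by unfold_locales (simp_all add: algebra_simps)

lemma is_ideal_0: "is_ideal I \<Longrightarrow> 0 \<in> I"
  unfolding is_ideal_def by (rule module.subspace_0[OF ring_module])

lemma is_ideal_add: "is_ideal I \<Longrightarrow> x \<in> I \<Longrightarrow> y \<in> I \<Longrightarrow> x + y \<in> I"
  unfolding is_ideal_def by (rule module.subspace_add[OF ring_module])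

lemma is_ideal_diff: "is_ideal I \<Longrightarrow> x \<in> I \<Longrightarrow> y \<in> I \<Longrightarrow> x - y \<in> I"
  unfolding is_ideal_def by (rule module.subspace_diff[OF ring_module])

lemma is_ideal_mult: "is_ideal I \<Longrightarrow> x \<in> I \<Longrightarrow> r * x \<in> I"
  unfolding is_ideal_def by (rule module.subspace_scale[OF ring_module])

lemma is_ideal_sum: "is_ideal I \<Longrightarrow> (\<And>x. x \<in> A \<Longrightarrow> f x \<in> I) \<Longrightarrow> (\<Sum>x\<in>A. f x) \<in> I"
  unfolding is_ideal_def by (rule module.subspace_sum[OF ring_module])

lemma is_ideal_ideal_of: "is_ideal (ideal_of S)"
  unfolding is_ideal_def ideal_of_def by (rule module.subspace_span[OF ring_module])

lemma ideal_of_base: "x \<in> S \<Longrightarrow> x \<in> ideal_of S"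
  unfolding ideal_of_def by (rule module.span_base[OF ring_module])

lemma ideal_of_minimal: "S \<subseteq> I \<Longrightarrow> is_ideal I \<Longrightarrow> ideal_of S \<subseteq> I"
  unfolding is_ideal_def ideal_of_def by (rule module.span_minimal[OF ring_module])

lemma ideal_of_explicit:
  assumes "x \<in> ideal_of S"
  obtains T r where "finite T" "T \<subseteq> S" "x = (\<Sum>a\<in>T. r a * a)"
  using assms unfolding ideal_of_def module.span_explicit[OF ring_module] by auto

text \<open>A scalar multiplication of its own gives span, independence and dimension over the
  coefficient field, next to the spans over the whole ring that define ideals.\<close>

definition scl :: "'k::field \<Rightarrow> ('v, 'k) mpol \<Rightarrow> ('v, 'k) mpol" where
  "scl c P = Const c * P"

interpretation scl: vector_space scl
  by unfold_locales (simp_all add: scl_def algebra_simps Const_add Const_mult)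

lemma lookup_scl [simp]: "lookup (scl c P) m = c * lookup P m"
  by (simp add: scl_def lookup_Const_mult)

lemma is_ideal_scl_subspace:
  fixes I :: "('v, 'k::field) mpol set"
  assumes "is_ideal I"
  shows "scl.subspace I"
  unfolding scl.subspace_def scl_def
  using assms by (auto intro: is_ideal_0 is_ideal_add is_ideal_mult)

lemma monomial_expansion: "P = (\<Sum>m\<in>keys P. scl (lookup P m) (monomial m))"
  by (subst sum_single_lookup[symmetric]) (simp add: scl_def monomial_def Const_mult_single)

lemma span_monomials: "scl.span (monomial ` A) = {P :: ('v, 'k::field) mpol. keys P \<subseteq> A}"
proof
  have "scl.subspace {P :: ('v, 'k) mpol. keys P \<subseteq> A}"
    unfolding scl.subspace_def
    by (auto simp: in_keys_iff subset_iff lookup_add) (metis add.right_neutral)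
  then show "scl.span (monomial ` A) \<subseteq> {P :: ('v, 'k) mpol. keys P \<subseteq> A}"
    by (rule scl.span_minimal[rotated]) (auto simp: monomial_def)
  show "{P :: ('v, 'k) mpol. keys P \<subseteq> A} \<subseteq> scl.span (monomial ` A)"
  proof
    fix P :: "('v, 'k) mpol"
    assume "P \<in> {P. keys P \<subseteq> A}"
    then have "(\<Sum>m\<in>keys P. scl (lookup P m) (monomial m)) \<in> scl.span (monomial ` A)"
      by (intro scl.span_sum scl.span_scale scl.span_base) auto
    then show "P \<in> scl.span (monomial ` A)"
      by (simp only: monomial_expansion[symmetric])
  qed
qed

lemma independent_monomials: "scl.independent (monomial ` A :: ('v, 'k::field) mpol set)"
proof
  assume "scl.dependent (monomial ` A :: ('v, 'k) mpol set)"
  then obtain P :: "('v, 'k) mpol" where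
    P: "P \<in> monomial ` A" "P \<in> scl.span (monomial ` A - {P})"
    unfolding scl.dependent_def by auto
  then obtain m where m: "P = monomial m" "m \<in> A" by auto
  have "monomial ` A - {P} = monomial ` (A - {m})"
    using inj_monomial m by (auto dest: injD)
  with P(2) m have "keys (monomial m :: ('v, 'k) mpol) \<subseteq> A - {m}"
    by (simp add: span_monomials)
  then show False
    by (simp add: monomial_def)
qed

section \<open>Homogeneous components and the degree of generators\<close>

definition hcomp :: "nat \<Rightarrow> ('v, 'k::comm_ring_1) mpol \<Rightarrow> ('v, 'k) mpol" where
  "hcomp n P = (\<Sum>m\<in>{m \<in> keys P. mdeg m = n}. single m (lookup P m))"

lemma lookup_hcomp: "lookup (hcomp n P) m = (if mdeg m = n then lookup P m else 0)"
  by (auto simp: hcomp_def lookup_sum lookup_single when_def in_keys_iff)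

lemma hcomp_id: "P \<in> forms n \<Longrightarrow> hcomp n P = P"
  by (rule poly_mapping_eqI) (auto simp: lookup_hcomp forms_iff)

lemma hcomp_add: "hcomp n (P + Q) = hcomp n P + hcomp n Q"
  by (rule poly_mapping_eqI) (auto simp: lookup_hcomp lookup_add)

lemma hcomp_sum: "hcomp n (\<Sum>x\<in>A. f x) = (\<Sum>x\<in>A. hcomp n (f x))"
  by (rule poly_mapping_eqI) (auto simp: lookup_hcomp lookup_sum)

lemma mdeg_eq_0: "mdeg m = 0 \<Longrightarrow> m = 0"
proof (rule poly_mapping_eqI)
  fix k
  assume "mdeg m = 0"
  then show "lookup m k = lookup 0 k"
    by (cases "k \<in> keys m") (auto simp: mdeg_def in_keys_iff)
qed

text \<open>Only the constant term of \<open>r\<close> contributes in degree \<open>d\<close>: each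
  other term lifts the terms of \<open>s\<close> above that degree.\<close>

lemma hcomp_mult_lowest:
  fixes s r :: "('v, 'k::field) mpol"
  assumes "\<And>m. m \<in> keys s \<Longrightarrow> d \<le> mdeg m"
  shows "hcomp d (r * s) = scl (lookup r 0) (hcomp d s)"
proof -
  define r' where "r' = r - Const (lookup r 0)"
  have r': "mdeg m > 0" if "m \<in> keys r'" for m
  proof -
    have "m \<noteq> 0"
      using that by (auto simp: r'_def in_keys_iff lookup_minus Const_def)
    then show ?thesis using mdeg_eq_0[of m] by auto
  qed
  have "mdeg m > d" if "m \<in> keys (r' * s)" for m
    using that keys_mult[of r' s] r' assms by (force simp: mdeg_add)
  then have 0: "hcomp d (r' * s) = 0"
    by (intro poly_mapping_eqI) (fastforce simp: lookup_hcomp in_keys_iff)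
  have "r * s = scl (lookup r 0) s + r' * s"
    by (simp add: r'_def scl_def algebra_simps)
  then have "hcomp d (r * s) = hcomp d (scl (lookup r 0) s)"
    by (simp add: hcomp_add 0)
  also have "\<dots> = scl (lookup r 0) (hcomp d s)"
    by (rule poly_mapping_eqI) (simp add: lookup_hcomp)
  finally show ?thesis .
qed

text \<open>In the lowest degree, ideal membership with polynomial coefficients becomes linear
  algebra over the field.\<close>

lemma hcomp_ideal_of:
  fixes S :: "('v, 'k::field) mpol set"
  assumes "\<And>s m. s \<in> S \<Longrightarrow> m \<in> keys s \<Longrightarrow> d \<le> mdeg m" and "P \<in> ideal_of S"
  shows "hcomp d P \<in> scl.span (hcomp d ` S)"
proof -
  obtain T r where T: "finite T" "T \<subseteq> S" "P = (\<Sum>s\<in>T. r s * s)"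
    using assms(2) by (rule ideal_of_explicit)
  have "hcomp d P = (\<Sum>s\<in>T. scl (lookup (r s) 0) (hcomp d s))"
    unfolding T(3) hcomp_sum using T(2) assms(1)
    by (intro sum.cong refl hcomp_mult_lowest) auto
  also have "\<dots> \<in> scl.span (hcomp d ` S)"
    using T(2) by (intro scl.span_sum scl.span_scale scl.span_base) auto
  finally show ?thesis .
qed

lemma forms_in_ideal_of:
  fixes S :: "('v, 'k::field) mpol set"
  assumes "S \<subseteq> forms d" "P \<in> ideal_of S" "P \<in> forms d"
  shows "P \<in> scl.span S"
proof -
  have "hcomp d P \<in> scl.span (hcomp d ` S)"
    using assms by (intro hcomp_ideal_of) (auto simp: forms_def)
  moreover have "hcomp d ` S = S"
    using assms(1) by (force simp: hcomp_id image_iff)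
  ultimately show ?thesis
    by (simp add: hcomp_id assms)
qed

lemma ideal_of_span: "scl.span S \<subseteq> ideal_of S"
  by (rule scl.span_minimal) (auto intro: ideal_of_base is_ideal_scl_subspace is_ideal_ideal_of)

lemma ideal_of_degree_ge:
  fixes S :: "('v, 'k::field) mpol set"
  assumes "S \<subseteq> forms d" "P \<in> ideal_of S" "m \<in> keys P"
  shows "d \<le> mdeg m"
proof -
  obtain T r where T: "finite T" "T \<subseteq> S" "P = (\<Sum>s\<in>T. r s * s)"
    using assms(2) by (rule ideal_of_explicit)
  have "lookup P m \<noteq> 0" using assms(3) by (simp add: in_keys_iff)
  then obtain s where "s \<in> T" "lookup (r s * s) m \<noteq> 0"
    unfolding T(3) lookup_sum using sum.not_neutral_contains_not_neutral by blast
  then show ?thesis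
    using keys_mult[of "r s" s] T(2) assms(1) by (fastforce simp: in_keys_iff[symmetric] mdeg_add forms_def)
qed

text \<open>Elements of \<open>I\<close> have no terms below degree \<open>d\<close>, so the degree
  \<open>d\<close> components of any generators, homogeneous or not, span a space containing the
  independent monomials of \<open>E\<close>.\<close>

lemma card_le_min_gens:
  fixes E :: "('v \<Rightarrow>\<^sub>0 nat) set"
  assumes "finite E" and "\<And>m. m \<in> E \<Longrightarrow> mdeg m = d"
  defines "I \<equiv> ideal_of (monomial ` E :: ('v, 'k::field) mpol set)"
  shows "card E \<le> min_gens I"
proof -
  have "\<exists>S. finite S \<and> card S = min_gens I \<and> ideal_of S = I"
    unfolding min_gens_def
    by (rule LeastI[of _ "card (monomial ` E :: ('v, 'k) mpol set)"])
      (use assms in \<open>auto simp: I_def\<close>)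
  then obtain S where S: "finite S" "card S = min_gens I" "ideal_of S = I"
    by blast
  have forms: "monomial ` E \<subseteq> (forms d :: ('v, 'k) mpol set)"
    using assms(2) by (auto simp: monomial_def)
  have "d \<le> mdeg m" if "s \<in> S" "m \<in> keys s" for s m
    using ideal_of_degree_ge[OF forms _ that(2)] ideal_of_base[OF that(1)] S(3) by (simp add: I_def)
  then have "hcomp d P \<in> scl.span (hcomp d ` S)" if "P \<in> I" for P
    using hcomp_ideal_of[of S d P] that S(3) by auto
  then have "P \<in> scl.span (hcomp d ` S)" if "P \<in> monomial ` E" for P
    using that forms ideal_of_base[OF that] hcomp_id[of P d] by (metis I_def subsetD)
  then have "monomial ` E \<subseteq> scl.span (hcomp d ` S)"
    by blast
  then have "card (monomial ` E :: ('v, 'k) mpol set) \<le> card (hcomp d ` S)"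
    using scl.independent_span_bound[OF _ independent_monomials] S(1) by blast
  also have "\<dots> \<le> card S"
    using S(1) by (rule card_image_le)
  also have "card (monomial ` E :: ('v, 'k) mpol set) = card E"
    by (intro card_image inj_on_subset[OF inj_monomial]) auto
  finally show ?thesis using S(2) by simp
qed

section \<open>Counting monomials in three variables\<close>

definition expo :: "nat \<Rightarrow> nat \<Rightarrow> nat \<Rightarrow> 3 \<Rightarrow>\<^sub>0 nat" where
  "expo i j k = single 1 i + single 2 j + single 3 k"

lemma lookup_expo [simp]:
  "lookup (expo i j k) 1 = i" "lookup (expo i j k) 2 = j" "lookup (expo i j k) 3 = k"
  by (simp_all add: expo_def lookup_add lookup_single when_def)

lemma mdeg_expo [simp]: "mdeg (expo i j k) = i + j + k"
  by (simp add: expo_def mdeg_add)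

lemma expo_eq_iff [simp]: "expo i j k = expo i' j' k' \<longleftrightarrow> i = i' \<and> j = j' \<and> k = k'"
  by (metis lookup_expo)

lemma expo_lookup: "expo (lookup m 1) (lookup m 2) (lookup m 3) = m"
  by (rule expvec_eqI) simp_all

lemma finite_bounded_expvecs: "finite {m :: 3 \<Rightarrow>\<^sub>0 nat. \<forall>i. lookup m i \<le> n}"
proof (rule finite_subset)
  show "{m. \<forall>i. lookup m i \<le> n} \<subseteq> (\<lambda>(i, j, k). expo i j k) ` ({..n} \<times> {..n} \<times> {..n})"
  proof
    fix m :: "3 \<Rightarrow>\<^sub>0 nat"
    assume "m \<in> {m. \<forall>i. lookup m i \<le> n}"
    then have "(lookup m 1, lookup m 2, lookup m 3) \<in> {..n} \<times> {..n} \<times> {..n}"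
      by simp
    then show "m \<in> (\<lambda>(i, j, k). expo i j k) ` ({..n} \<times> {..n} \<times> {..n})"
      using expo_lookup[of m] by (metis (mono_tags, lifting) case_prod_conv image_eqI)
  qed
qed simp

lemma lookup_le_mdeg: "lookup m i \<le> mdeg m"
  by (cases "i \<in> keys m") (auto simp: mdeg_def in_keys_iff intro: member_le_sum)

lemma finite_mdeg: "finite {m :: 3 \<Rightarrow>\<^sub>0 nat. mdeg m = n}"
  by (rule finite_subset[OF _ finite_bounded_expvecs[of n]]) (auto intro: lookup_le_mdeg)

text \<open>\<open>A\<close> consists of the monomials divisible by the first variable and
  \<open>B\<close> of those free of it. For \<open>n = d - 1\<close> the summand
  \<open>Suc (Suc n)\<close> is the bound \<open>d + 1\<close> of the theorem.\<close>

lemma card_mdeg_Suc: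
  "card {m :: 3 \<Rightarrow>\<^sub>0 nat. mdeg m = n} + Suc (Suc n) \<le> card {m :: 3 \<Rightarrow>\<^sub>0 nat. mdeg m = Suc n}"
proof -
  define A where "A = (\<lambda>m. m + single 1 1) ` {m :: 3 \<Rightarrow>\<^sub>0 nat. mdeg m = n}"
  define B where "B = (\<lambda>j. expo 0 j (Suc n - j)) ` {..Suc n}"
  have "card A = card {m :: 3 \<Rightarrow>\<^sub>0 nat. mdeg m = n}"
    unfolding A_def by (intro card_image inj_onI) simp
  moreover have "card B = Suc (Suc n)"
    unfolding B_def by (subst card_image) (auto intro!: inj_onI)
  moreover have "A \<inter> B = {}"
  proof -
    have "lookup m 1 \<noteq> 0" if "m \<in> A" for m
      using that by (auto simp: A_def lookup_add lookup_single)
    moreover have "lookup m 1 = 0" if "m \<in> B" for m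
      using that by (auto simp: B_def)
    ultimately show ?thesis by blast
  qed
  moreover have "finite A" "finite B"
    by (auto simp: A_def B_def finite_mdeg)
  ultimately have "card {m :: 3 \<Rightarrow>\<^sub>0 nat. mdeg m = n} + Suc (Suc n) = card (A \<union> B)"
    by (simp add: card_Un_disjoint)
  also have "\<dots> \<le> card {m :: 3 \<Rightarrow>\<^sub>0 nat. mdeg m = Suc n}"
    by (intro card_mono finite_mdeg) (auto simp: A_def B_def mdeg_add)
  finally show ?thesis .
qed

section \<open>Cosets and the multiplication map\<close>

lemma coset_base:
  assumes "is_ideal I"
  shows "f \<in> f +o I"
proof -
  have "f + 0 \<in> f +o I"
    unfolding elt_set_plus_def using is_ideal_0[OF assms] by blast
  then show ?thesis by simp
qed

lemma coset_eq_iff: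
  assumes "is_ideal I"
  shows "f +o I = g +o I \<longleftrightarrow> f - g \<in> I"
proof
  assume "f +o I = g +o I"
  then have "f \<in> g +o I"
    using coset_base[OF assms] by blast
  then show "f - g \<in> I"
    by (auto simp: elt_set_plus_def)
next
  have *: "f +o I \<subseteq> g +o I" if "f - g \<in> I" for f g
  proof
    fix x assume "x \<in> f +o I"
    then obtain y where "y \<in> I" "x = f + y" unfolding elt_set_plus_def by blast
    then have "x = g + ((f - g) + y)" "(f - g) + y \<in> I"
      using that assms by (auto intro: is_ideal_add)
    then show "x \<in> g +o I" unfolding elt_set_plus_def by blast
  qed
  assume fg: "f - g \<in> I"
  then have "g - f \<in> I"
    using is_ideal_diff[OF assms is_ideal_0[OF assms] fg] by simp
  with fg show "f +o I = g +o I"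
    using * by blast
qed

lemma mult_map_coset:
  assumes "is_ideal I"
  shows "mult_map I L (f +o I) = (L * f) +o I"
proof -
  have "(L * g) +o I = (L * f) +o I" if g: "g \<in> f +o I" for g
  proof -
    obtain y where y: "y \<in> I" "g = f + y" using g unfolding elt_set_plus_def by blast
    then have "L * g - L * f = L * y" by (simp add: algebra_simps)
    then show ?thesis
      using y is_ideal_mult[OF assms] by (simp add: coset_eq_iff[OF assms])
  qed
  moreover have "f \<in> f +o I"
    by (rule coset_base[OF assms])
  ultimately show ?thesis
    unfolding mult_map_def by blast
qed

lemma not_inj_mult_map:
  assumes "is_ideal I" "f \<in> forms n" "f \<notin> I" "L * f \<in> I"
  shows "\<not> inj_on (mult_map I L) (quot_piece I n)"
proof
  assume "inj_on (mult_map I L) (quot_piece I n)"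
  moreover have "mult_map I L (f +o I) = mult_map I L (0 +o I)"
    unfolding mult_map_coset[OF assms(1)] coset_eq_iff[OF assms(1)] using assms(4) by simp
  moreover have "f +o I \<in> quot_piece I n" "0 +o I \<in> quot_piece I n"
    using assms(2) unfolding quot_piece_def by (blast intro: forms_0)+
  ultimately have "f +o I = 0 +o I"
    by (rule inj_onD)
  then show False
    using assms by (simp only: coset_eq_iff) simp
qed

lemma not_surj_mult_map:
  fixes L f :: "'k::field pol3"
  assumes E: "\<And>m. m \<in> E \<Longrightarrow> mdeg m = Suc n" "card E \<le> Suc (Suc n)"
    and L: "L \<in> forms 1" and f: "f \<in> forms n" "f \<noteq> 0" "L * f \<in> ideal_of (monomial ` E)"
  defines "I \<equiv> ideal_of (monomial ` E)"
  shows "mult_map I L ` quot_piece I n \<noteq> quot_piece I (Suc n)"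
proof
  assume surj: "mult_map I L ` quot_piece I n = quot_piece I (Suc n)"
  have ideal: "is_ideal I" by (simp add: I_def is_ideal_ideal_of)
  have finE: "finite E"
    by (rule finite_subset[OF _ finite_mdeg[of "Suc n"]]) (use E(1) in auto)
  have E_forms: "monomial ` E \<subseteq> (forms (Suc n) :: 'k pol3 set)"
    using E(1) by (auto simp: monomial_def)
  have L_forms: "L * g \<in> forms (Suc n)" if "g \<in> forms n" for g
    using forms_mult[OF L that] by simp
  obtain m0 where m0: "m0 \<in> keys f"
    using f(2) by (metis keys_eq_empty ex_in_conv)
  define D where "D = {m :: 3 \<Rightarrow>\<^sub>0 nat. mdeg m = n}"
  have finD: "finite D" by (simp add: D_def finite_mdeg)
  have m0D: "m0 \<in> D" using m0 f(1) by (auto simp: D_def forms_def)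
  text \<open>The relation \<open>L * f \<in> I\<close> makes \<open>L * monomial m0\<close> redundant, so that surjectivity would give
    fewer generators of the degree \<open>n + 1\<close> piece than its dimension.\<close>
  define T where "T = (\<lambda>m. L * monomial m) ` (D - {m0}) \<union> monomial ` E"
  have expand: "L * g = (\<Sum>m\<in>keys g. scl (lookup g m) (L * monomial m))" for g
    by (subst (1) monomial_expansion[of g]) (simp add: sum_distrib_left scl_def mult_ac)
  have I_span: "P \<in> scl.span T" if "P \<in> I" "P \<in> forms (Suc n)" for P
    using forms_in_ideal_of[OF E_forms _ that(2)] that(1)
      scl.span_mono[of "monomial ` E" T] by (auto simp: I_def T_def)
  have T1: "L * monomial m \<in> scl.span T" if "m \<in> D" "m \<noteq> m0" for m
    using that by (auto simp: T_def intro: scl.span_base)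
  have "L * f = scl (lookup f m0) (L * monomial m0)
      + (\<Sum>m\<in>keys f - {m0}. scl (lookup f m) (L * monomial m))"
    using m0 by (subst expand[of f]) (simp add: sum.remove)
  then have "scl (lookup f m0) (L * monomial m0) =
      L * f - (\<Sum>m\<in>keys f - {m0}. scl (lookup f m) (L * monomial m))"
    by (simp add: algebra_simps)
  also have "\<dots> \<in> scl.span T"
  proof (rule scl.span_diff)
    show "L * f \<in> scl.span T"
      using f L_forms by (intro I_span) (auto simp: I_def)
    show "(\<Sum>m\<in>keys f - {m0}. scl (lookup f m) (L * monomial m)) \<in> scl.span T"
      using f(1) by (intro scl.span_sum scl.span_scale T1) (auto simp: D_def forms_def)
  qed
  finally have "scl (inverse (lookup f m0)) (scl (lookup f m0) (L * monomial m0)) \<in> scl.span T"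
    by (rule scl.span_scale)
  then have "L * monomial m0 \<in> scl.span T"
    using m0 by (simp add: in_keys_iff)
  then have T2: "L * monomial m \<in> scl.span T" if "m \<in> D" for m
    using T1 that by (cases "m = m0") auto
  have "P \<in> scl.span T" if P: "P \<in> forms (Suc n)" for P
  proof -
    have "P +o I \<in> mult_map I L ` quot_piece I n"
      using P surj by (auto simp: quot_piece_def)
    then obtain g where g: "g \<in> forms n" "P +o I = (L * g) +o I"
      by (auto simp: quot_piece_def mult_map_coset[OF ideal])
    then have "P - L * g \<in> scl.span T"
      using P by (intro I_span) (auto simp: coset_eq_iff[OF ideal] intro: forms_diff L_forms)
    moreover have "L * g \<in> scl.span T"
      using g(1) by (subst expand[of g], intro scl.span_sum scl.span_scale T2) (auto simp: D_def forms_def)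
    ultimately show ?thesis
      using scl.span_add by fastforce
  qed
  then have "monomial ` {m. mdeg m = Suc n} \<subseteq> scl.span T"
    by (auto simp: monomial_def)
  moreover have "finite T"
    using finD finE by (simp add: T_def)
  ultimately have "card (monomial ` {m :: 3 \<Rightarrow>\<^sub>0 nat. mdeg m = Suc n} :: 'k pol3 set) \<le> card T"
    using scl.independent_span_bound[OF \<open>finite T\<close> independent_monomials] by blast
  moreover have "card (monomial ` {m :: 3 \<Rightarrow>\<^sub>0 nat. mdeg m = Suc n} :: 'k pol3 set)
      = card {m :: 3 \<Rightarrow>\<^sub>0 nat. mdeg m = Suc n}"
    by (intro card_image inj_on_subset[OF inj_monomial]) auto
  moreover have "card T \<le> card (D - {m0}) + card E"
    unfolding T_def using finD finE
    by (intro order_trans[OF card_Un_le] add_mono card_image_le) auto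
  moreover have "card (D - {m0}) < card D"
    using finD m0D by (rule card_Diff1_less)
  \<comment> \<open>\<open>card T\<close> is at most \<open>card D - 1 + (n + 2)\<close>, one less
    than the number of monomials guaranteed by \<open>card_mdeg_Suc\<close>.\<close>
  ultimately show False
    using card_mdeg_Suc[of n] E(2) by (simp add: D_def)
qed

section \<open>The artinian condition and the lattice point count\<close>

text \<open>A vector of \<open>T\<close> outside \<open>S\<close> would extend a basis of
  \<open>S\<close> to an independent subset of \<open>T\<close> with more than \<open>dim T\<close>
  elements. The finite \<open>B\<close> ensures that the cardinalities compared are those of finite
  sets.\<close>

lemma (in vector_space) subspace_eq_of_dim_le:
  assumes "subspace S" "S \<subseteq> T" "T \<subseteq> span B" "finite B" "dim T \<le> dim S"
  shows "S = T"
proof (rule ccontr)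
  assume "S \<noteq> T"
  then obtain x where x: "x \<in> T" "x \<notin> S" using assms(2) by blast
  obtain A where A: "A \<subseteq> S" "independent A" "S \<subseteq> span A" "card A = dim S"
    by (rule basis_exists)
  obtain C where C: "C \<subseteq> T" "independent C" "T \<subseteq> span C" "card C = dim T"
    by (rule basis_exists)
  have "span A \<subseteq> S"
    using A(1) assms(1) by (rule span_minimal)
  then have "x \<notin> span A" using x(2) by blast
  then have indep: "independent (insert x A)" and "x \<notin> A"
    using independent_insertI[OF _ A(2)] span_base by auto
  have finC: "finite C"
    using independent_span_bound[OF assms(4) C(2)] C(1) assms(3) by blast
  have "insert x A \<subseteq> span C"
    using x(1) A(1) assms(2) C(3) by blast
  then have "finite (insert x A) \<and> card (insert x A) \<le> card C"
    by (rule independent_span_bound[OF finC indep])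
  moreover from this have "card (insert x A) = Suc (card A)"
    using \<open>x \<notin> A\<close> by (intro card_insert_disjoint) auto
  ultimately show False
    using A(4) C(4) assms(5) by linarith
qed

text \<open>Modulo \<open>I\<close> only the monomials with all exponents at most \<open>d\<close>
  matter. Each member of the chain is therefore determined by its intersection with their
  finite-dimensional span.\<close>

lemma artinian_ideal_of_pure_powers:
  fixes I :: "'k::field pol3 set"
  assumes "is_ideal I" and powers: "\<And>i. monomial (single i d) \<in> I"
  shows "artinian_ideal I"
  unfolding artinian_ideal_def
proof (intro conjI allI impI)
  show "is_ideal I" by fact
  fix J :: "nat \<Rightarrow> 'k pol3 set"
  assume chain: "\<forall>n. is_ideal (J n) \<and> I \<subseteq> J n \<and> J (Suc n) \<subseteq> J n"
  then have ideal: "is_ideal (J n)" and sub: "I \<subseteq> J n" for n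
    by auto
  have anti: "J n \<subseteq> J N" if "N \<le> n" for n N
    using that by (rule lift_Suc_antimono_le[rotated]) (use chain in auto)
  define B where "B = {m :: 3 \<Rightarrow>\<^sub>0 nat. \<forall>i. lookup m i \<le> d}"
  have finB: "finite (monomial ` B :: 'k pol3 set)"
    by (simp add: B_def finite_bounded_expvecs)
  have big: "monomial m \<in> I" if m: "m \<notin> B" for m
  proof -
    obtain i where i: "lookup m i \<ge> d"
      using m by (auto simp: B_def not_le intro: less_imp_le)
    have "m = (m - single i d) + single i d"
      by (rule poly_mapping_eqI) (use i in \<open>auto simp: lookup_add lookup_minus lookup_single when_def\<close>)
    then have "(monomial m :: 'k pol3) = monomial (m - single i d) * monomial (single i d)"
      by (metis monomial_def mult.right_neutral mult_single)
    then show ?thesis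
      using is_ideal_mult[OF assms(1) powers] by simp
  qed
  define W where "W n = J n \<inter> scl.span (monomial ` B)" for n
  \<comment> \<open>An index of least dimension: from there on the decreasing subspaces
    \<open>W n\<close> cannot shrink any further.\<close>
  obtain N where N: "scl.dim (W N) \<le> scl.dim (W n)" for n
    using ex_has_least_nat[of "\<lambda>_. True" 0 "\<lambda>n. scl.dim (W n)"] by auto
  have "J n = J N" if "N \<le> n" for n
  proof
    show "J n \<subseteq> J N" by (rule anti) fact
    have "W n = W N"
    proof (rule scl.subspace_eq_of_dim_le[OF _ _ _ finB N])
      show "scl.subspace (W n)"
        unfolding W_def by (intro scl.subspace_inter is_ideal_scl_subspace ideal scl.subspace_span)
    qed (use anti[OF that] in \<open>auto simp: W_def\<close>)
    show "J N \<subseteq> J n"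
    proof
      fix P assume P: "P \<in> J N"
      define Q where "Q = (\<Sum>m\<in>keys P \<inter> B. scl (lookup P m) (monomial m))"
      define R where "R = (\<Sum>m\<in>keys P - B. scl (lookup P m) (monomial m))"
      have "P = Q + R"
        unfolding Q_def R_def
        by (subst monomial_expansion[of P], subst sum.Int_Diff[of _ _ B]) auto
      moreover have "R \<in> I"
        unfolding R_def scl_def by (intro is_ideal_sum is_ideal_mult assms(1) big) auto
      ultimately have PQ: "P - Q \<in> I" by simp
      have "P - (P - Q) \<in> J N"
        using sub PQ by (rule is_ideal_diff[OF ideal P subsetD])
      then have "Q \<in> J N" by simp
      moreover have "Q \<in> scl.span (monomial ` B)"
        unfolding Q_def by (intro scl.span_sum scl.span_scale scl.span_base) auto
      ultimately have "Q \<in> J n"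
        using \<open>W n = W N\<close> by (auto simp: W_def)
      then have "Q + (P - Q) \<in> J n"
        using sub PQ by (rule is_ideal_add[OF ideal _ subsetD])
      then show "P \<in> J n" by simp
    qed
  qed
  then show "\<exists>N. \<forall>n\<ge>N. J n = J N" by blast
qed

text \<open>The kernel of a homomorphism from (Z/m)^2 to Z/m, written with representatives. By
  pigeonhole some fibre has at least \<open>m\<close> of the \<open>m * m\<close> elements, and
  translating it by one of its own points moves it into the kernel.\<close>

lemma card_kernel_mod:
  fixes m \<beta> \<gamma> :: nat
  assumes "m > 0"
  shows "m \<le> card {(i, j). i < m \<and> j < m \<and> m dvd \<beta> * i + \<gamma> * j}" (is "_ \<le> card ?K")
proof -
  define val where "val = (\<lambda>(i, j). (\<beta> * i + \<gamma> * j) mod m)"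
  let ?A = "{..<m} \<times> {..<m}"
  have "(\<Sum>r\<in>{..<m}. \<Sum>x\<in>{x \<in> ?A. val x = r}. 1 :: nat) = (\<Sum>x\<in>?A. 1)"
    using assms by (intro sum.group) (auto simp: val_def)
  then have sum: "(\<Sum>r<m. card {x \<in> ?A. val x = r}) = m * m"
    by simp
  have "\<exists>r. m \<le> card {x \<in> ?A. val x = r}"
  proof (rule ccontr)
    assume "\<not> (\<exists>r. m \<le> card {x \<in> ?A. val x = r})"
    then have "card {x \<in> ?A. val x = r} < m" for r
      by (simp add: not_le)
    then have "(\<Sum>r<m. card {x \<in> ?A. val x = r}) < (\<Sum>r<m. m)"
      using assms by (intro sum_strict_mono) auto
    then show False using sum by simp
  qed
  then obtain r where r: "m \<le> card {x \<in> ?A. val x = r}" ..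
  define F where "F = {x \<in> ?A. val x = r}"
  have "card F > 0" using r assms by (simp add: F_def)
  then have "F \<noteq> {}" by auto
  then obtain i0 j0 where 0: "(i0, j0) \<in> F" by auto
  then have less: "i0 < m" "j0 < m" by (auto simp: F_def)
  \<comment> \<open>Adding \<open>m - i0\<close> subtracts \<open>i0\<close> modulo \<open>m\<close>
    without leaving the natural numbers.\<close>
  define sh where "sh = (\<lambda>(i, j). ((i + (m - i0)) mod m, (j + (m - j0)) mod m))"
  have shift_inj: "i = i'" if "i < m" "i' < m" "s < m" "(i + (m - s)) mod m = (i' + (m - s)) mod m"
    for i i' s :: nat
  proof -
    have "(i + (m - s) + s) mod m = (i' + (m - s) + s) mod m"
      using that(4) by (metis mod_add_left_eq)
    then show ?thesis using that by simp
  qed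
  have "inj_on sh F"
  proof (rule inj_onI, clarify)
    fix i j i' j'
    assume "(i, j) \<in> F" "(i', j') \<in> F" "sh (i, j) = sh (i', j')"
    then show "i = i' \<and> j = j'"
      using shift_inj[of i i' i0] shift_inj[of j j' j0] less by (simp add: sh_def F_def)
  qed
  moreover have "sh ` F \<subseteq> ?K"
  proof -
    have "m dvd \<beta> * ((i + (m - i0)) mod m) + \<gamma> * ((j + (m - j0)) mod m)" if "(i, j) \<in> F" for i j
    proof -
      have eq: "(\<beta> * i + \<gamma> * j) mod m = (\<beta> * i0 + \<gamma> * j0) mod m"
        using that 0 by (simp add: F_def val_def)
      have "(\<beta> * ((i + (m - i0)) mod m) + \<gamma> * ((j + (m - j0)) mod m)) mod m
          = (\<beta> * (i + (m - i0)) + \<gamma> * (j + (m - j0))) mod m"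
        by (intro mod_add_cong mod_mult_cong) simp_all
      also have "\<dots> = ((\<beta> * i + \<gamma> * j) + (\<beta> * (m - i0) + \<gamma> * (m - j0))) mod m"
        by (simp add: algebra_simps)
      also have "\<dots> = ((\<beta> * i0 + \<gamma> * j0) + (\<beta> * (m - i0) + \<gamma> * (m - j0))) mod m"
        by (rule mod_add_cong[OF eq refl])
      also have "(\<beta> * i0 + \<gamma> * j0) + (\<beta> * (m - i0) + \<gamma> * (m - j0))
          = \<beta> * (i0 + (m - i0)) + \<gamma> * (j0 + (m - j0))"
        by (simp only: distrib_left ac_simps)
      also have "\<dots> = (\<beta> + \<gamma>) * m"
        using less by (simp add: distrib_right)
      finally show ?thesis by (simp add: mod_eq_0_iff_dvd)
    qed
    then show ?thesis using assms by (auto simp: sh_def)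
  qed
  moreover have "finite ?K"
    by (rule finite_subset[of _ ?A]) auto
  ultimately have "card F \<le> card ?K"
    by (rule card_inj_on_le)
  then show ?thesis using r by (simp add: F_def)
qed

lemma card_kernel_triangle:
  fixes g m \<beta> \<gamma> :: nat
  assumes "g \<ge> 2" "m > 0"
  shows "g * m + 2 \<le> card {(i, j). i + j \<le> g * m \<and> m dvd \<beta> * i + \<gamma> * j}" (is "_ \<le> card ?N")
proof -
  text \<open>A kernel point \<open>x\<close> of the box \<open>[0, m) \<times> [0, m)\<close> has \<open>card (W x)\<close> translates by \<open>m\<close>-multiples
    in the triangle.  Pairing \<open>x\<close> with its negative modulo \<open>m\<close>, which swaps the two halves of
    the box, gives at least \<open>g\<close> translates per kernel point on average.\<close>
  define K where "K = {(i, j). i < m \<and> j < m \<and> m dvd \<beta> * i + \<gamma> * j}"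
  define W where "W = (\<lambda>(i, j). {(p, q). i + j + (p + q) * m \<le> g * m})"
  define neg where "neg = (\<lambda>(i, j). ((m - i) mod m, (m - j) mod m))"
  have finK: "finite K"
    by (rule finite_subset[of _ "{..<m} \<times> {..<m}"]) (auto simp: K_def)
  have finW: "finite (W x)" for x
  proof (rule finite_subset)
    show "W x \<subseteq> {..g} \<times> {..g}"
    proof
      fix y assume "y \<in> W x"
      then have "fst x + snd x + (fst y + snd y) * m \<le> g * m"
        by (simp add: W_def split_beta)
      then have "(fst y + snd y) * m \<le> g * m"
        by (rule add_leD2)
      then have "fst y + snd y \<le> g"
        using assms(2) by (simp only: mult_le_cancel2)
      then show "y \<in> {..g} \<times> {..g}" by (auto simp: mem_Times_iff)
    qed
  qed simp
  \<comment> \<open>The two rows \<open>p = 0\<close> and \<open>p = 1\<close> of translates already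
    give all the estimates below.\<close>
  have W_row: "card (W x) \<ge> n0 + n1"
    if "\<And>q. q < n0 \<Longrightarrow> (0, q) \<in> W x" "\<And>q. q < n1 \<Longrightarrow> (1, q) \<in> W x" for x n0 n1
  proof -
    have "card ({0 :: nat} \<times> {..<n0} \<union> {1} \<times> {..<n1}) = n0 + n1"
      by (subst card_Un_disjoint) (auto simp: card_cartesian_product)
    moreover have "{0} \<times> {..<n0} \<union> {1} \<times> {..<n1} \<subseteq> W x"
      using that by auto
    ultimately show ?thesis
      using card_mono[OF finW] by metis
  qed
  have mem_W: "(p, q) \<in> W (i, j)" if "i + j \<le> k * m" "k + p + q \<le> g" for p q i j k
  proof -
    have "i + j + (p + q) * m \<le> (k + p + q) * m"
      using that(1) by (simp add: algebra_simps)
    also have "\<dots> \<le> g * m" using that(2) by simp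
    finally show ?thesis by (simp add: W_def)
  qed
  \<comment> \<open>The admissible translates satisfy \<open>p + q \<le> g\<close>,
    \<open>g - 1\<close> or \<open>g - 2\<close>, according as \<open>i + j\<close> is bounded by 0,
    \<open>m\<close> or \<open>2 * m\<close>; row 0 alone serves in the last case.\<close>
  have W_0: "card (W (0, 0)) \<ge> 2 * g + 1"
    using W_row[of "Suc g" "(0, 0)" g] mem_W[of 0 0 0] by simp
  have W_small: "card (W (i, j)) \<ge> 2 * g - 1" if "i + j \<le> m" for i j
    using W_row[of g "(i, j)" "g - 1"] mem_W[of i j 1] that by simp
  have W_large: "card (W (i, j)) \<ge> g - 1" if "i < m" "j < m" for i j
    using W_row[of "g - 1" "(i, j)" 0] mem_W[of i j 2] that by simp
  have W_neg: "card (W x) + card (W (neg x)) \<ge> 2 * g" if x: "x \<in> K - {(0, 0)}" for x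
  proof -
    obtain i j where ij: "x = (i, j)" "i < m" "j < m" using x by (auto simp: K_def)
    define i' j' where "i' = (m - i) mod m" and "j' = (m - j) mod m"
    have neg_x: "neg x = (i', j')" by (simp add: neg_def ij i'_def j'_def)
    have less: "i' < m" "j' < m" using assms by (simp_all add: i'_def j'_def)
    have "i' \<le> m - i" "j' \<le> m - j" by (simp_all add: i'_def j'_def)
    \<comment> \<open>The four coordinates add up to at most \<open>2 * m\<close>, so the point or
      its negative lies in the lower half of the box.\<close>
    then have "i + j \<le> m \<or> i' + j' \<le> m" using ij by linarith
    then show ?thesis
      using W_small[of i j] W_large[of i j] W_small[of i' j'] W_large[of i' j'] less ij assms(1)
      unfolding neg_x by auto
  qed
  have neg_neg: "neg (neg x) = x" if "x \<in> K" for x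
  proof -
    have "(m - (m - i) mod m) mod m = i" if "i < m" for i
      using that by (cases "i = 0") auto
    then show ?thesis using that by (auto simp: K_def neg_def)
  qed
  have neg_K: "neg x \<in> K" if x: "x \<in> K" for x
  proof -
    obtain i j where ij: "x = (i, j)" "i < m" "j < m" "m dvd \<beta> * i + \<gamma> * j"
      using x by (auto simp: K_def)
    have "(\<beta> * i + \<gamma> * j) + (\<beta> * (m - i) + \<gamma> * (m - j)) = \<beta> * (i + (m - i)) + \<gamma> * (j + (m - j))"
      by (simp only: distrib_left ac_simps)
    also have "\<dots> = (\<beta> + \<gamma>) * m"
      using ij by (simp add: distrib_right)
    finally have "m dvd \<beta> * (m - i) + \<gamma> * (m - j)"
      using ij(4) by (metis dvd_add_right_iff dvd_triv_right)
    moreover have "(\<beta> * ((m - i) mod m) + \<gamma> * ((m - j) mod m)) mod m = (\<beta> * (m - i) + \<gamma> * (m - j)) mod m"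
      by (intro mod_add_cong mod_mult_cong) simp_all
    ultimately have "m dvd \<beta> * ((m - i) mod m) + \<gamma> * ((m - j) mod m)"
      by (simp only: dvd_eq_mod_eq_0)
    then show ?thesis using assms by (simp add: K_def neg_def ij)
  qed
  have "bij_betw neg K K"
    by (rule bij_betw_byWitness[where f' = neg]) (auto simp: neg_neg intro: neg_K)
  then have sum_neg: "(\<Sum>x\<in>K. card (W (neg x))) = (\<Sum>x\<in>K. card (W x))"
    by (rule sum.reindex_bij_betw)
  have 0: "(0, 0) \<in> K" using assms by (simp add: K_def)
  have "card K \<ge> m"
    using card_kernel_mod[OF assms(2)] by (simp add: K_def)
  \<comment> \<open>The origin is its own negative and contributes \<open>2 * g + 1\<close> twice;
    at least \<open>m - 1\<close> other kernel points contribute \<open>2 * g\<close> each together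
    with their negatives. The surplus \<open>g + 1\<close> over \<open>g * m\<close> comes from the
    origin.\<close>
  have "2 * (g * m + g + 1) \<le> 2 * (2 * g + 1) + (m - 1) * (2 * g)"
    using assms by (cases m) (auto simp: algebra_simps)
  also have "\<dots> \<le> (card (W (0, 0)) + card (W (neg (0, 0)))) + (\<Sum>x\<in>K - {(0, 0)}. 2 * g)"
    using W_0 \<open>card K \<ge> m\<close> 0 finK by (intro add_mono) (auto simp: neg_def)
  also have "\<dots> \<le> (card (W (0, 0)) + card (W (neg (0, 0))))
      + (\<Sum>x\<in>K - {(0, 0)}. card (W x) + card (W (neg x)))"
    by (intro add_mono sum_mono W_neg) auto
  also have "\<dots> = (\<Sum>x\<in>K. card (W x) + card (W (neg x)))"
    by (rule sum.remove[OF finK 0, symmetric])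
  also have "\<dots> = 2 * (\<Sum>x\<in>K. card (W x))"
    by (simp add: sum.distrib sum_neg)
  also have "(\<Sum>x\<in>K. card (W x)) = card (Sigma K W)"
    using finK finW by simp
  finally have "g * m + g + 1 \<le> card (Sigma K W)" by simp
  \<comment> \<open>Division with remainder by \<open>m\<close> recovers the kernel point and the
    translation from each coordinate pair.\<close>
  also have "\<dots> \<le> card ?N"
  proof (rule card_inj_on_le)
    let ?f = "\<lambda>((i, j), (p, q)). (i + p * m, j + q * m)"
    show "inj_on ?f (Sigma K W)"
    proof (rule inj_onI)
      have *: "i = i' \<and> p = p'" if "i < m" "i' < m" "i + p * m = i' + p' * m" for i i' p p'
      proof -
        have "(i + p * m) mod m = (i' + p' * m) mod m" "(i + p * m) div m = (i' + p' * m) div m"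
          using that by simp_all
        then show ?thesis using that(1,2) by simp
      qed
      fix x y
      assume "x \<in> Sigma K W" "y \<in> Sigma K W" "?f x = ?f y"
      then show "x = y"
        by (auto simp: K_def dest: *)
    qed
    show "?f ` Sigma K W \<subseteq> ?N"
    proof clarify
      fix i j p q
      assume "(i, j) \<in> K" "(p, q) \<in> W (i, j)"
      then have "i + j + (p + q) * m \<le> g * m" "m dvd \<beta> * i + \<gamma> * j"
        by (auto simp: K_def W_def)
      moreover have "\<beta> * (i + p * m) + \<gamma> * (j + q * m) = (\<beta> * i + \<gamma> * j) + (\<beta> * p + \<gamma> * q) * m"
        by (simp add: algebra_simps)
      ultimately have "i + p * m + (j + q * m) \<le> g * m"
        "m dvd \<beta> * (i + p * m) + \<gamma> * (j + q * m)"
        by (simp_all add: distrib_right)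
      then show "i + p * m + (j + q * m) \<le> g * m \<and> m dvd \<beta> * (i + p * m) + \<gamma> * (j + q * m)" ..
    qed
    show "finite ?N"
      by (rule finite_subset[of _ "{..g * m} \<times> {..g * m}"]) auto
  qed
  finally show ?thesis using assms by linarith
qed

text \<open>Invariance is put as a divisibility without the root of unity, which makes it a lattice
  condition; \<open>mem_E_iff\<close> translates back.\<close>

definition invariant_exponents :: "nat \<Rightarrow> nat \<Rightarrow> nat \<Rightarrow> nat \<Rightarrow> (3 \<Rightarrow>\<^sub>0 nat) set" where
  "invariant_exponents d a b c =
     {m. mdeg m = d \<and> d dvd a * lookup m 1 + b * lookup m 2 + c * lookup m 3}"

text \<open>In degree \<open>d\<close> the weight equals
  \<open>a * d + (b - a) * i + (c - a) * j\<close>, where \<open>i\<close> and \<open>j\<close> are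
  the exponents of y and z. Cancelling \<open>g\<close> turns divisibility by \<open>d\<close> into
  divisibility by \<open>m = d / g\<close>, while the triangle keeps its side \<open>g * m\<close>;
  the sparser condition on the full triangle is what produces too many points.\<close>

lemma card_invariant_exponents_gcd:
  assumes "d > 0" "a \<le> b" "b \<le> c" and "gcd (b - a) (gcd (c - a) d) \<noteq> 1"
  shows "d + 2 \<le> card (invariant_exponents d a b c)"
proof -
  define g where "g = gcd (b - a) (gcd (c - a) d)"
  have "g \<noteq> 0" using assms(1) by (simp add: g_def)
  with assms(4) have g: "g \<ge> 2" unfolding g_def[symmetric] by linarith
  have "g dvd b - a" "g dvd c - a" "g dvd d"
    by (simp_all add: g_def) (meson dvd_trans gcd_dvd1 gcd_dvd2)+
  then obtain \<beta> \<gamma> m where eqs: "b - a = g * \<beta>" "c - a = g * \<gamma>" "d = g * m"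
    by (elim dvdE)
  have "m > 0" using assms(1) eqs(3) by (cases m) auto
  have "d + 2 \<le> card {(i, j). i + j \<le> g * m \<and> m dvd \<beta> * i + \<gamma> * j}"
    using card_kernel_triangle[OF g \<open>m > 0\<close>] eqs(3) by simp
  also have "\<dots> \<le> card (invariant_exponents d a b c)"
  proof (rule card_inj_on_le)
    let ?f = "\<lambda>(i, j). expo (d - i - j) i j"
    show "inj_on ?f {(i, j). i + j \<le> g * m \<and> m dvd \<beta> * i + \<gamma> * j}"
      by (auto simp: inj_on_def)
    show "finite (invariant_exponents d a b c)"
      unfolding invariant_exponents_def by (rule finite_subset[OF _ finite_mdeg[of d]]) auto
    show "?f ` {(i, j). i + j \<le> g * m \<and> m dvd \<beta> * i + \<gamma> * j} \<subseteq> invariant_exponents d a b c"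
    proof clarify
      fix i j
      assume ij: "i + j \<le> g * m" "m dvd \<beta> * i + \<gamma> * j"
      have bc: "b = a + g * \<beta>" "c = a + g * \<gamma>"
        using eqs assms by linarith+
      obtain l where l: "d = l + i + j"
        using ij(1) eqs(3) by (metis add.commute add.left_commute le_Suc_ex)
      have "a * l + b * i + c * j = a * d + g * (\<beta> * i + \<gamma> * j)"
        unfolding bc l by (simp add: algebra_simps)
      moreover have "d dvd g * (\<beta> * i + \<gamma> * j)"
        using ij(2) eqs(3) by (simp add: mult_dvd_mono)
      ultimately have "d dvd a * l + b * i + c * j" by simp
      then show "expo (d - i - j) i j \<in> invariant_exponents d a b c"
        by (simp add: invariant_exponents_def l)
    qed
  qed
  finally show ?thesis .
qed

section \<open>The diagonal action and the Weak Lefschetz Property\<close>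

definition weight :: "nat \<Rightarrow> nat \<Rightarrow> nat \<Rightarrow> (3 \<Rightarrow>\<^sub>0 nat) \<Rightarrow> nat" where
  "weight a b c m = a * lookup m 1 + b * lookup m 2 + c * lookup m 3"

definition rot :: "'k::field \<Rightarrow> nat \<Rightarrow> nat \<Rightarrow> nat \<Rightarrow> (3 \<Rightarrow> 'k) \<Rightarrow> 3 \<Rightarrow> 'k" where
  "rot e a b c u = (\<lambda>i. e ^ triple a b c i * u i)"

lemma triple_simps [simp]: "triple p q r 1 = p" "triple p q r 2 = q" "triple p q r 3 = r"
  by (simp_all add: triple_def)

lemma Var_power: "Var i ^ n = (monomial (single i n) :: ('v, 'k::comm_ring_1) mpol)"
  by (induction n) (simp_all add: monomial_def Var_def mult_single single_add[symmetric])

lemma monomial_mult: "monomial m * monomial n = (monomial (m + n) :: ('v, 'k::comm_ring_1) mpol)"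
  by (simp add: monomial_def mult_single)

lemma act_expand: "act e a b c P = (\<Sum>m\<in>keys P. single m (e ^ weight a b c m * lookup P m))"
proof -
  have "mon (triple (Const (e ^ a) * Var 1) (Const (e ^ b) * Var 2) (Const (e ^ c) * Var 3)) m
      = Const (e ^ weight a b c m) * monomial m" for m
  proof -
    have "mon (triple (Const (e ^ a) * Var 1) (Const (e ^ b) * Var 2) (Const (e ^ c) * Var 3)) m
      = Const (e ^ weight a b c m) * (Var 1 ^ lookup m 1 * Var 2 ^ lookup m 2 * Var 3 ^ lookup m 3)"
      by (simp add: mon_3 weight_def power_mult_distrib power_add power_mult Const_mult Const_power mult_ac)
    also have "Var 1 ^ lookup m 1 * Var 2 ^ lookup m 2 * Var 3 ^ lookup m 3 = (monomial m :: 'a pol3)"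
      using expo_lookup[of m] by (simp add: Var_power monomial_mult expo_def)
    finally show ?thesis .
  qed
  then have "act e a b c P = (\<Sum>m\<in>keys P. Const (lookup P m) * (Const (e ^ weight a b c m) * monomial m))"
    by (simp add: act_def subst_Const.subst_mon)
  then show ?thesis
    by (simp add: monomial_def Const_mult_single mult.commute[of "e ^ _"])
qed

lemma lookup_act: "lookup (act e a b c P) m = e ^ weight a b c m * lookup P m"
  by (auto simp: act_expand lookup_sum lookup_single when_def in_keys_iff)

lemma act_prod: "act e a b c (\<Prod>x\<in>A. f x) = (\<Prod>x\<in>A. act e a b c (f x))"
  by (simp add: act_def subst_Const.subst_prod)

lemma act_act: "act e a b c (act f a b c P) = act (e * f) a b c P"
  by (rule poly_mapping_eqI) (simp add: lookup_act power_mult_distrib)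

lemma act_one [simp]: "act 1 a b c P = P"
  by (rule poly_mapping_eqI) (simp add: lookup_act)

lemma act_forms: "P \<in> forms n \<Longrightarrow> act e a b c P \<in> forms n"
  by (auto simp: forms_iff lookup_act)

lemma mon_rot: "mon (rot e a b c u) m = e ^ weight a b c m * mon u m"
  by (simp add: mon_3 rot_def weight_def power_mult_distrib power_add power_mult mult_ac)

lemma evaluate_act: "evaluate u (act e a b c P) = evaluate (rot e a b c u) P"
  unfolding act_expand evaluate.subst_sum evaluate.subst_single evaluate.subst_mon[of _ P] mon_rot
  by (simp add: mult_ac)

section \<open>Invariants of the cyclic group generated by the matrix\<close>

locale diagonal_action =
  fixes d a b c :: nat and e :: "'k::field_char_0"
  assumes d_ge_3: "d \<ge> 3" and root: "primitive_root_of_1 d e"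
begin

abbreviation "E \<equiv> invariant_exponents d a b c"
abbreviation "I \<equiv> ideal_of (monomial ` E :: 'k pol3 set)"

lemma root_power_eq_1_iff: "e ^ n = 1 \<longleftrightarrow> d dvd n"
proof
  assume "e ^ n = 1"
  have "e ^ n = (e ^ d) ^ (n div d) * e ^ (n mod d)"
    by (simp add: power_mult[symmetric] power_add[symmetric])
  then have "e ^ (n mod d) = 1"
    using \<open>e ^ n = 1\<close> root by (simp add: primitive_root_of_1_def)
  moreover have "n mod d < d" using d_ge_3 by simp
  ultimately have "n mod d = 0"
    using root by (metis gr0I primitive_root_of_1_def)
  then show "d dvd n" by (simp only: dvd_eq_mod_eq_0)
next
  assume "d dvd n"
  then show "e ^ n = 1"
    using root by (auto simp: primitive_root_of_1_def power_mult)
qed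

lemma root_nonzero: "e \<noteq> 0"
  using root_power_eq_1_iff[of d] d_ge_3 by (auto simp: power_0_left)

lemma root_power_mod: "e ^ (n mod d) = e ^ n"
proof -
  have "e ^ n = e ^ (d * (n div d)) * e ^ (n mod d)"
    by (simp add: power_add[symmetric])
  then show ?thesis by (simp add: root_power_eq_1_iff)
qed

lemma mem_E_iff: "m \<in> E \<longleftrightarrow> mdeg m = d \<and> e ^ weight a b c m = 1"
  by (simp add: invariant_exponents_def weight_def root_power_eq_1_iff)

lemma finite_E: "finite E"
  by (rule finite_subset[OF _ finite_mdeg[of d]]) (auto simp: mem_E_iff)

lemma invariant_monomials_eq: "invariant_monomials d e a b c = monomial ` E"
proof -
  have "act e a b c (monomial m) = monomial m \<longleftrightarrow> e ^ weight a b c m = 1" for m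
  proof
    assume "act e a b c (monomial m) = monomial m"
    then have "lookup (act e a b c (monomial m)) m = lookup (monomial m :: 'k pol3) m"
      by simp
    then show "e ^ weight a b c m = 1"
      by (simp add: lookup_act lookup_monomial)
  next
    assume "e ^ weight a b c m = 1"
    then show "act e a b c (monomial m) = monomial m"
      by (intro poly_mapping_eqI) (simp add: lookup_act lookup_monomial)
  qed
  then have "invariant_monomials d e a b c = {monomial m | m. m \<in> E}"
    by (simp add: invariant_monomials_def mem_E_iff)
  then show ?thesis by blast
qed

text \<open>A diagonal action scales each monomial separately, so a form is invariant only if all
  its monomials are. This reconciles the ideal of the theorem, given by monomials, with the one in
  \<open>GT_system\<close>, given by forms.\<close>

lemma invariant_forms_eq: "invariant_forms d e a b c = {P. keys P \<subseteq> E}"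
proof -
  have "act e a b c P = P \<longleftrightarrow> (\<forall>m\<in>keys P. e ^ weight a b c m = 1)" for P
  proof
    assume "act e a b c P = P"
    then have "e ^ weight a b c m * lookup P m = lookup P m" for m
      by (metis lookup_act)
    then show "\<forall>m\<in>keys P. e ^ weight a b c m = 1"
      by (auto simp: in_keys_iff)
  next
    assume "\<forall>m\<in>keys P. e ^ weight a b c m = 1"
    then show "act e a b c P = P"
      by (intro poly_mapping_eqI) (auto simp: lookup_act in_keys_iff)
  qed
  then show ?thesis
    unfolding invariant_forms_def forms_def subset_iff mem_E_iff by blast
qed

lemma span_E: "scl.span (monomial ` E) = invariant_forms d e a b c"
  by (simp add: span_monomials invariant_forms_eq)

lemma E_forms: "monomial ` E \<subseteq> forms d"
  by (auto simp: monomial_def mem_E_iff)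

lemma ideal_I: "is_ideal I"
  by (rule is_ideal_ideal_of)

lemma I_forms_eq: "I \<inter> forms d = invariant_forms d e a b c"
  using forms_in_ideal_of[OF E_forms] ideal_of_span[of "monomial ` E"] span_E
  by (auto simp: invariant_forms_def)

lemma ideal_of_invariant_forms: "ideal_of (invariant_forms d e a b c) = I"
proof
  show "ideal_of (invariant_forms d e a b c) \<subseteq> I"
    by (rule ideal_of_minimal[OF _ ideal_I]) (use I_forms_eq in blast)
  show "I \<subseteq> ideal_of (invariant_forms d e a b c)"
    by (rule ideal_of_minimal[OF _ is_ideal_ideal_of])
      (use span_E scl.span_superset[of "monomial ` E"] ideal_of_base in blast)
qed

lemma card_E_le: "card E \<le> min_gens I"
  by (rule card_le_min_gens[OF finite_E]) (auto simp: mem_E_iff)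

lemma pure_power_in_E: "single i d \<in> E"
  using exhaust_three[of i]
  by (auto simp: invariant_exponents_def lookup_single when_def)

lemma artinian_I: "artinian_ideal I"
  by (rule artinian_ideal_of_pure_powers[OF ideal_I]) (auto intro: ideal_of_base pure_power_in_E)

text \<open>The factors are indexed by exponents \<open>k < d\<close> and not by distinct
  translates, so the norm of a linear form has degree \<open>d\<close> even if some translates
  coincide.\<close>

definition orbit_norm :: "'k pol3 \<Rightarrow> 'k pol3" where
  "orbit_norm L = (\<Prod>k<d. act (e ^ k) a b c L)"

text \<open>Applying the matrix shifts the factors cyclically, since the factor with index
  \<open>d\<close> is the one with index 0.\<close>

lemma orbit_norm_invariant:
  assumes "L \<in> forms 1"
  shows "orbit_norm L \<in> invariant_forms d e a b c"
proof -
  have "orbit_norm L \<in> forms (card {..<d} * 1)"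
    unfolding orbit_norm_def using assms by (intro forms_prod act_forms) auto
  moreover have "act e a b c (orbit_norm L) = orbit_norm L"
  proof -
    let ?f = "\<lambda>k. act (e ^ k) a b c L"
    obtain n where n: "d = Suc n" using d_ge_3 by (cases d) auto
    have "act e a b c (orbit_norm L) = (\<Prod>k<d. ?f (Suc k))"
      by (simp add: orbit_norm_def act_prod act_act)
    also have "\<dots> = (\<Prod>k<n. ?f (Suc k)) * ?f d"
      by (simp add: n)
    also have "?f d = ?f 0"
      using root by (simp add: primitive_root_of_1_def)
    also have "(\<Prod>k<n. ?f (Suc k)) * ?f 0 = orbit_norm L"
      unfolding orbit_norm_def unfolding n prod.lessThan_Suc_shift by (simp add: mult.commute)
    finally show ?thesis .
  qed
  ultimately show ?thesis by (simp add: invariant_forms_def)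
qed

lemma orbit_norm_factor:
  "orbit_norm L = L * (\<Prod>k\<in>{1..<d}. act (e ^ k) a b c L)"
proof -
  have "{..<d} - {0} = {1..<d}" by auto
  then show ?thesis
    unfolding orbit_norm_def using d_ge_3 by (subst prod.remove[of _ 0]) auto
qed

lemma act_nonzero:
  assumes "L \<noteq> 0"
  shows "act (e ^ k) a b c L \<noteq> 0"
proof -
  obtain m where "lookup L m \<noteq> 0"
    using assms by (metis lookup_zero poly_mapping_eqI)
  then have "lookup (act (e ^ k) a b c L) m \<noteq> 0"
    using root_nonzero by (simp add: lookup_act)
  then show ?thesis by auto
qed

lemma fails_WLP:
  assumes "card E \<le> d + 1"
  shows "fails_WLP_from I (d - 1)"
  unfolding fails_WLP_from_def
proof
  fix L :: "'k pol3"
  assume L: "L \<in> forms 1"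
  obtain f where f: "f \<in> forms (d - 1)" "f \<noteq> 0" "L * f \<in> I"
  proof (cases "L = 0")
    \<comment> \<open>The zero polynomial belongs to \<open>forms 1\<close> as well; it annihilates
      everything, so any nonzero form serves.\<close>
    case True
    show ?thesis
    proof (rule that[of "monomial (single 1 (d - 1))"])
      show "monomial (single 1 (d - 1)) \<noteq> (0 :: 'k pol3)"
        by (metis keys_single keys_zero insert_not_empty monomial_def zero_neq_one)
    qed (use True is_ideal_0[OF ideal_I] in \<open>auto simp: monomial_def\<close>)
  next
    case False
    let ?f = "\<Prod>k\<in>{1..<d}. act (e ^ k) a b c L"
    show ?thesis
    proof (rule that[of ?f])
      have "?f \<in> forms (card {1..<d} * 1)"
        using L by (intro forms_prod act_forms) auto
      then show "?f \<in> forms (d - 1)" by simp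
      show "?f \<noteq> 0"
        using act_nonzero[OF False] by simp
      show "L * ?f \<in> I"
        using orbit_norm_invariant[OF L] orbit_norm_factor[of L] I_forms_eq by auto
    qed
  qed
  have "f \<notin> I"
  proof
    assume "f \<in> I"
    obtain m where "m \<in> keys f" using f(2) by (metis keys_eq_empty ex_in_conv)
    then have "d \<le> d - 1"
      using ideal_of_degree_ge[OF E_forms \<open>f \<in> I\<close>] f(1) by (auto simp: forms_def)
    then show False using d_ge_3 by simp
  qed
  then have "\<not> inj_on (mult_map I L) (quot_piece I (d - 1))"
    using not_inj_mult_map[OF ideal_I] f by blast
  moreover have "mult_map I L ` quot_piece I (d - 1) \<noteq> quot_piece I (Suc (d - 1))"
    by (rule not_surj_mult_map[OF _ _ L f]) (use assms d_ge_3 in \<open>auto simp: mem_E_iff\<close>)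
  ultimately show "\<not> maximal_rank I L (d - 1)"
    by (simp add: maximal_rank_def)
qed

end

section \<open>Orbits and the covering\<close>

lemma proj_pt_mem: "u \<in> proj_pt u"
  unfolding proj_pt_def by (auto intro!: exI[of _ 1])

lemma proj_pt_scale:
  assumes "t \<noteq> 0"
  shows "proj_pt (\<lambda>i. t * u i) = proj_pt u"
proof -
  have "(\<lambda>i. s * u i) \<in> proj_pt (\<lambda>i. t * u i)" if "s \<noteq> 0" for s
    unfolding proj_pt_def using assms that by (auto intro!: exI[of _ "s / t"])
  moreover have "(\<lambda>i. s * (t * u i)) \<in> proj_pt u" if "s \<noteq> 0" for s
    unfolding proj_pt_def using assms that by (auto intro!: exI[of _ "s * t"])
  ultimately show ?thesis
    unfolding proj_pt_def[of u] proj_pt_def[of "\<lambda>i. t * u i"] by blast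
qed

lemma proj_pt_eqD:
  assumes "proj_pt u = proj_pt v"
  obtains t where "t \<noteq> 0" "u = (\<lambda>i. t * v i)"
proof -
  have "u \<in> proj_pt v"
    using proj_pt_mem[of u] assms by simp
  then show ?thesis
    using that unfolding proj_pt_def by blast
qed

lemma proj_pt_in_P2_iff: "proj_pt u \<in> P2 \<longleftrightarrow> u \<noteq> (\<lambda>_. 0)"
proof
  assume "proj_pt u \<in> P2"
  then obtain v where v: "proj_pt u = proj_pt v" "v \<noteq> (\<lambda>_. 0)"
    by (auto simp: proj_space_def)
  then obtain t where "t \<noteq> 0" "v = (\<lambda>i. t * u i)"
    by (metis proj_pt_eqD)
  with v(2) show "u \<noteq> (\<lambda>_. 0)" by auto
qed (auto simp: proj_space_def)

lemma P2_cases: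
  assumes "p \<in> P2"
  obtains u where "p = proj_pt u" "u \<noteq> (\<lambda>_. 0)"
  using assms by (auto simp: proj_space_def)

text \<open>Equality of points through vanishing 2x2 minors. Being polynomial in the coordinates,
  this criterion can be tested on all points at once.\<close>

lemma proj_pt_eqI:
  assumes "u \<noteq> (\<lambda>_. 0)" "v \<noteq> (\<lambda>_. 0)" and "\<And>i j. u i * v j = u j * v i"
  shows "proj_pt u = proj_pt v"
proof -
  obtain i where i: "u i \<noteq> 0" using assms(1) by auto
  define t where "t = v i / u i"
  have v: "v = (\<lambda>j. t * u j)"
    using i assms(3)[of i] by (auto simp: t_def field_simps)
  then have "t \<noteq> 0"
    using assms(2) by auto
  then have "proj_pt (\<lambda>j. t * u j) = proj_pt u"
    by (rule proj_pt_scale)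
  then show ?thesis by (simp only: v)
qed

definition lin_form :: "'k::comm_ring_1 \<Rightarrow> 'k \<Rightarrow> 'k \<Rightarrow> 'k pol3" where
  "lin_form x y z = Const x * Var 1 + Const y * Var 2 + Const z * Var 3"

lemma lin_form_forms: "lin_form x y z \<in> forms 1"
  unfolding lin_form_def by (intro forms_add forms_Const_mult forms_Var)

lemma evaluate_lin_form: "evaluate u (lin_form x y z) = x * u 1 + y * u 2 + z * u 3"
  by (simp add: lin_form_def evaluate.subst_add evaluate.subst_mult evaluate.subst_Const
      evaluate.subst_Var)

lemma lin_form_eq_0: "lin_form x y z = 0 \<Longrightarrow> x = 0 \<and> y = 0 \<and> z = 0"
proof -
  assume 0: "lin_form x y z = 0"
  have "evaluate u (lin_form x y z) = 0" for u
    using 0 by simp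
  then have "x * triple p q r 1 + y * triple p q r 2 + z * triple p q r 3 = 0" for p q r
    by (simp only: evaluate_lin_form)
  from this[of 1 0 0] this[of 0 1 0] this[of 0 0 1] show ?thesis by simp
qed

lemma rot_rot: "rot e a b c (rot f a b c u) = rot (e * f) a b c u"
  by (simp add: rot_def power_mult_distrib mult.assoc)

lemma rot_one [simp]: "rot 1 a b c u = u"
  by (simp add: rot_def)

lemma rot_scale: "rot e a b c (\<lambda>i. t * u i) = (\<lambda>i. t * rot e a b c u i)"
  by (simp add: rot_def mult_ac)

lemma Fract_add_same: "F \<noteq> 0 \<Longrightarrow> Fract (P + Q) F = Fract P F + Fract Q F"
  by (simp add: eq_fract algebra_simps)

interpretation Fract_Const: coeff_hom "\<lambda>t :: 'k::field. Fract (Const t) 1 :: ('v::linorder, 'k) mpol fract"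
  by unfold_locales (simp_all add: Const_add Const_mult Zero_fract_def One_fract_def)

context diagonal_action
begin

lemma pure_power_invariant: "monomial (single i d) \<in> invariant_forms d e a b c"
  unfolding span_E[symmetric] by (intro scl.span_base imageI pure_power_in_E)

lemma orbit_separation:
  assumes u: "u \<noteq> (\<lambda>_. 0)" and v: "v \<noteq> (\<lambda>_. 0)"
    and sep: "\<And>P. P \<in> invariant_forms d e a b c \<Longrightarrow> evaluate v P = 0 \<Longrightarrow> evaluate u P = 0"
  obtains k where "k < d" "proj_pt v = proj_pt (rot (e ^ k) a b c u)"
proof (atomize_elim, rule ccontr)
  assume "\<nexists>k. k < d \<and> proj_pt v = proj_pt (rot (e ^ k) a b c u)"
  then have distinct: "proj_pt v \<noteq> proj_pt (rot (e ^ k) a b c u)" if "k < d" for k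
    using that by blast
  text \<open>The linear form \<open>x \<mapsto> det (s, v, x)\<close> vanishes at \<open>v\<close>, and for a suitable \<open>s\<close> it vanishes
    at no point of the orbit of \<open>u\<close>; its norm then separates \<open>v\<close> from \<open>u\<close>.\<close>
  define w where "w k = rot (e ^ k) a b c u" for k
  \<comment> \<open>As a function of \<open>s\<close>, \<open>Q k\<close> is det (s, v, w k); its
    coefficients form the cross product of \<open>v\<close> and \<open>w k\<close>, which vanishes
    only if these are proportional.\<close>
  define Q where "Q k = lin_form (v 2 * w k 3 - v 3 * w k 2) (v 3 * w k 1 - v 1 * w k 3)
    (v 1 * w k 2 - v 2 * w k 1)" for k
  have "Q k \<noteq> 0" if "k < d" for k
  proof
    assume "Q k = 0"
    then have "v 2 * w k 3 = v 3 * w k 2" "v 3 * w k 1 = v 1 * w k 3" "v 1 * w k 2 = v 2 * w k 1"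
      using lin_form_eq_0 unfolding Q_def by fastforce+
    then have "v i * w k j = v j * w k i" for i j
      using exhaust_three[of i] exhaust_three[of j] by auto
    moreover have "w k \<noteq> (\<lambda>_. 0)"
      using u root_nonzero by (auto simp: w_def rot_def fun_eq_iff)
    ultimately have "proj_pt v = proj_pt (w k)"
      by (intro proj_pt_eqI v)
    then show False using distinct[OF that] by (simp add: w_def)
  qed
  then have "(\<Prod>k<d. Q k) \<noteq> 0" by simp
  then obtain s where "evaluate s (\<Prod>k<d. Q k) \<noteq> 0" by (rule nonvanishing_point)
  then have s: "evaluate s (Q k) \<noteq> 0" if "k < d" for k
    using that by (simp add: evaluate.subst_prod)
  define L where "L = lin_form (s 2 * v 3 - s 3 * v 2) (s 3 * v 1 - s 1 * v 3)
    (s 1 * v 2 - s 2 * v 1)"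
  have eval_norm: "evaluate x (orbit_norm L) = (\<Prod>k<d. evaluate (rot (e ^ k) a b c x) L)" for x
    by (simp add: orbit_norm_def evaluate.subst_prod evaluate_act)
  have "evaluate (rot (e ^ 0) a b c v) L = 0"
    by (simp add: L_def evaluate_lin_form algebra_simps)
  then have "evaluate v (orbit_norm L) = 0"
    unfolding eval_norm using d_ge_3 by (intro prod_zero bexI[of _ 0]) auto
  moreover have "evaluate (w k) L = evaluate s (Q k)" for k
    by (simp add: L_def Q_def evaluate_lin_form algebra_simps)
  then have "evaluate u (orbit_norm L) \<noteq> 0"
    using s by (simp add: eval_norm w_def)
  moreover have "orbit_norm L \<in> invariant_forms d e a b c"
    unfolding L_def by (intro orbit_norm_invariant lin_form_forms)
  ultimately show False using sep by blast
qed

lemma evaluate_rot_invariant: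
  assumes "P \<in> invariant_forms d e a b c"
  shows "evaluate (rot (e ^ k) a b c u) P = evaluate u P"
proof (induction k)
  case (Suc k)
  have "evaluate (rot (e ^ Suc k) a b c u) P = evaluate (rot e a b c (rot (e ^ k) a b c u)) P"
    by (simp add: rot_rot)
  also have "\<dots> = evaluate (rot (e ^ k) a b c u) (act e a b c P)"
    by (simp only: evaluate_act)
  finally show ?case
    using assms Suc by (simp add: invariant_forms_def)
qed simp

end

text \<open>The last condition of \<open>GT_system\<close> quantifies over lists of generators, so
  the morphism is studied for an arbitrary one.\<close>

locale generating_forms = diagonal_action +
  fixes Fs :: "'a pol3 list"
  assumes Fs_forms: "set Fs \<subseteq> forms d" and Fs_generate: "ideal_of (set Fs) = I"
begin

lemma Fs_invariant: "set Fs \<subseteq> invariant_forms d e a b c"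
  using Fs_forms Fs_generate I_forms_eq ideal_of_base by blast

lemma invariant_in_span:
  assumes "P \<in> invariant_forms d e a b c"
  shows "P \<in> scl.span (set Fs)"
  using assms I_forms_eq Fs_generate by (intro forms_in_ideal_of[OF Fs_forms]) auto

text \<open>The relation is linear in the form, so it spreads from \<open>Fs\<close> to its span,
  which contains every invariant form. The value \<open>t = 0\<close> excludes base points; a
  nonzero \<open>t\<close> expresses that \<open>u\<close> and \<open>v\<close> have the same
  image.\<close>

lemma evaluate_proportional:
  assumes "P \<in> invariant_forms d e a b c"
    and "\<And>F. F \<in> set Fs \<Longrightarrow> evaluate u F = t * evaluate v F"
  shows "evaluate u P = t * evaluate v P"
proof -
  have "scl.subspace {P. evaluate u P = t * evaluate v P}"
    unfolding scl.subspace_def scl_def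
    by (auto simp: evaluate.subst_add evaluate.subst_mult evaluate.subst_Const algebra_simps)
  then have "scl.span (set Fs) \<subseteq> {P. evaluate u P = t * evaluate v P}"
    by (rule scl.span_minimal[rotated]) (use assms(2) in auto)
  then show ?thesis using invariant_in_span[OF assms(1)] by blast
qed

text \<open>A common zero of \<open>Fs\<close> would be a common zero of x^d, y^d and z^d.\<close>

lemma values_at_nonzero:
  assumes "u \<noteq> (\<lambda>_. 0)"
  shows "values_at Fs u \<noteq> (\<lambda>_. 0)"
proof
  assume 0: "values_at Fs u = (\<lambda>_. 0)"
  have "evaluate u F = 0 * evaluate u F" if "F \<in> set Fs" for F
  proof -
    obtain j where "j < length Fs" "F = Fs ! j"
      using \<open>F \<in> set Fs\<close> by (metis in_set_conv_nth)
    then show ?thesis using fun_cong[OF 0, of j] by (simp add: values_at_def)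
  qed
  then have "evaluate u (monomial (single i d)) = 0" for i
    using evaluate_proportional[OF pure_power_invariant, of u 0 u] by simp
  then have "u i ^ d = 0" for i
    by (simp add: monomial_def evaluate.subst_single mon_single)
  then show False using assms by auto
qed

lemma values_at_scale: "values_at Fs (\<lambda>i. t * u i) = (\<lambda>j. t ^ d * values_at Fs u j)"
  using Fs_forms by (auto simp: values_at_def fun_eq_iff intro!: evaluate_scaled)

lemma phi_proj_pt: "phi Fs (proj_pt u) = proj_pt (values_at Fs u)"
proof -
  have "proj_pt (values_at Fs v) = proj_pt (values_at Fs u)" if "v \<in> proj_pt u" for v
    using that by (auto simp: proj_pt_def[of u] values_at_scale proj_pt_scale)
  then show ?thesis
    unfolding phi_def using proj_pt_mem[of u] by blast
qed

lemma phi_eq_orbit: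
  assumes "u \<noteq> (\<lambda>_. 0)" "v \<noteq> (\<lambda>_. 0)" "phi Fs (proj_pt u) = phi Fs (proj_pt v)"
  obtains k where "k < d" "proj_pt v = proj_pt (rot (e ^ k) a b c u)"
proof (rule orbit_separation[OF assms(1,2)])
  obtain t where t: "t \<noteq> 0" "values_at Fs u = (\<lambda>j. t * values_at Fs v j)"
    using assms(3) unfolding phi_proj_pt by (rule proj_pt_eqD)
  fix P
  assume P: "P \<in> invariant_forms d e a b c" "evaluate v P = 0"
  have "evaluate u F = t * evaluate v F" if "F \<in> set Fs" for F
  proof -
    obtain j where "j < length Fs" "F = Fs ! j"
      using \<open>F \<in> set Fs\<close> by (metis in_set_conv_nth)
    then show ?thesis using fun_cong[OF t(2), of j] by (simp add: values_at_def)
  qed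
  from evaluate_proportional[OF P(1) this] P(2) show "evaluate u P = 0" by simp
qed

lemma phi_rot: "phi Fs (proj_pt (rot (e ^ k) a b c u)) = phi Fs (proj_pt u)"
proof -
  have "values_at Fs (rot (e ^ k) a b c u) = values_at Fs u"
    using Fs_invariant evaluate_rot_invariant by (force simp: values_at_def fun_eq_iff)
  then show ?thesis by (simp add: phi_proj_pt)
qed

lemma finite_over_chart:
  assumes F: "F \<in> set Fs" "F \<noteq> 0"
  shows "finite_over (preimage_chart_ring d F) (image_chart_ring Fs F)"
proof -
  define A where "A = image_chart_ring Fs F"
  let ?s = "subst (\<lambda>t. Fract (Const t) 1) (\<lambda>j::nat. if j < length Fs then Fract (Fs ! j) F else 0)"
  have A_eq: "A = range ?s" by (simp add: A_def image_chart_ring_def)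
  have A_add: "x + y \<in> A" if xy: "x \<in> A" "y \<in> A" for x y
  proof -
    obtain p q where "x = ?s p" "y = ?s q" using xy unfolding A_eq by blast
    then have "x + y = ?s (p + q)" by (simp only: Fract_Const.subst_add)
    then show ?thesis unfolding A_eq by blast
  qed
  have A_mult: "x * y \<in> A" if xy: "x \<in> A" "y \<in> A" for x y
  proof -
    obtain p q where "x = ?s p" "y = ?s q" using xy unfolding A_eq by blast
    then have "x * y = ?s (p * q)" by (simp only: Fract_Const.subst_mult)
    then show ?thesis unfolding A_eq by blast
  qed
  have A_Const: "Fract (Const t) 1 \<in> A" for t
  proof -
    have "Fract (Const t) 1 = ?s (Const t)" by (simp only: Fract_Const.subst_Const)
    then show ?thesis unfolding A_eq by blast
  qed
  have A_0: "0 \<in> A" and A_1: "1 \<in> A"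
    using A_Const[of 0] A_Const[of 1] by (simp_all add: Zero_fract_def One_fract_def)
  have A_Fs: "Fract G F \<in> A" if "G \<in> set Fs" for G
  proof -
    obtain j where "j < length Fs" "G = Fs ! j"
      using \<open>G \<in> set Fs\<close> by (metis in_set_conv_nth)
    then have "Fract G F = ?s (Var j)" by (simp add: Fract_Const.subst_Var)
    then show ?thesis unfolding A_eq by blast
  qed
  have A_invariant: "Fract P F \<in> A" if "P \<in> invariant_forms d e a b c" for P
  proof -
    have "scl.subspace {P. Fract P F \<in> A}"
      unfolding scl.subspace_def
    proof (intro conjI ballI allI; clarify)
      show "Fract 0 F \<in> A" using A_0 by (simp add: fract_collapse)
      show "Fract (P + Q) F \<in> A" if "Fract P F \<in> A" "Fract Q F \<in> A" for P Q
        unfolding Fract_add_same[OF F(2)] using that by (rule A_add)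
      show "Fract (scl t P) F \<in> A" if "Fract P F \<in> A" for t P
        using A_mult[OF A_Const[of t] that] by (simp add: scl_def)
    qed
    then have "scl.span (set Fs) \<subseteq> {P. Fract P F \<in> A}"
      by (rule scl.span_minimal[rotated]) (use A_Fs in auto)
    then show ?thesis using invariant_in_span[OF that] by blast
  qed
  text \<open>Dividing a monomial by \<open>x\<^sup>d\<close>, \<open>y\<^sup>d\<close>, \<open>z\<^sup>d\<close> leaves bounded exponents, so the finite set \<open>S\<close>
    spans the chart ring as an \<open>A\<close>-module.\<close>
  define R where "R = {m :: 3 \<Rightarrow>\<^sub>0 nat. (\<forall>i. lookup m i \<le> d) \<and> d dvd mdeg m}"
  define S where "S = (\<lambda>m. Fract (monomial m) (F ^ (mdeg m div d))) ` R"
  have finS: "finite S"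
    unfolding S_def R_def by (intro finite_imageI finite_subset[OF _ finite_bounded_expvecs[of d]]) auto
  define M where "M = {x. \<exists>r. (\<forall>s\<in>S. r s \<in> A) \<and> x = (\<Sum>s\<in>S. r s * s)}"
  have M_0: "0 \<in> M"
    unfolding M_def using A_0 by (auto intro!: exI[of _ "\<lambda>_. 0"])
  have M_add: "x + y \<in> M" if xy: "x \<in> M" "y \<in> M" for x y
  proof -
    obtain r r' where "\<forall>s\<in>S. r s \<in> A" "x = (\<Sum>s\<in>S. r s * s)" "\<forall>s\<in>S. r' s \<in> A" "y = (\<Sum>s\<in>S. r' s * s)"
      using xy unfolding M_def by blast
    then have "(\<forall>s\<in>S. r s + r' s \<in> A) \<and> x + y = (\<Sum>s\<in>S. (r s + r' s) * s)"
      by (auto simp: distrib_right sum.distrib intro: A_add)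
    then show ?thesis
      unfolding M_def by (intro CollectI exI[of _ "\<lambda>s. r s + r' s"])
  qed
  have M_mult: "x * y \<in> M" if xy: "x \<in> A" "y \<in> M" for x y
  proof -
    obtain r where "\<forall>s\<in>S. r s \<in> A" "y = (\<Sum>s\<in>S. r s * s)"
      using xy unfolding M_def by blast
    then have "(\<forall>s\<in>S. x * r s \<in> A) \<and> x * y = (\<Sum>s\<in>S. (x * r s) * s)"
      using xy(1) by (auto simp: sum_distrib_left mult.assoc intro: A_mult)
    then show ?thesis
      unfolding M_def by (intro CollectI exI[of _ "\<lambda>s. x * r s"])
  qed
  have M_S: "s \<in> M" if "s \<in> S" for s
  proof -
    have "(\<Sum>s'\<in>S. (if s' = s then 1 else 0) * s') = (\<Sum>s'\<in>S. if s' = s then s' else 0)"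
      by (intro sum.cong) auto
    then have "s = (\<Sum>s'\<in>S. (if s' = s then 1 else 0) * s')"
      using that finS by simp
    then show ?thesis
      unfolding M_def using A_0 A_1 by (auto intro!: exI[of _ "\<lambda>s'. if s' = s then 1 else 0"])
  qed
  \<comment> \<open>Induction on the power of \<open>F\<close>: an exponent of at least
    \<open>d\<close> allows a pure power to be split off, whose quotient by \<open>F\<close> lies in
    \<open>A\<close>; if there is none, the quotient is itself in \<open>S\<close>.\<close>
  have M_monomial: "Fract (monomial m) (F ^ n) \<in> M" if "mdeg m = n * d" for m n
    using that
  proof (induction n arbitrary: m)
    case 0
    then have "m = 0" by (simp add: mdeg_eq_0)
    then have "Fract (monomial m) (F ^ 0) \<in> S"
      by (auto simp: S_def R_def intro!: image_eqI[of _ _ 0])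
    then show ?case by (rule M_S)
  next
    case (Suc n)
    show ?case
    proof (cases "\<forall>i. lookup m i \<le> d")
      case True
      have "mdeg m div d = Suc n" using Suc.prems d_ge_3 by simp
      then have "Fract (monomial m) (F ^ Suc n) \<in> S"
        using True Suc.prems by (auto simp: S_def R_def intro!: image_eqI[of _ _ m])
      then show ?thesis by (rule M_S)
    next
      case False
      then obtain i where "lookup m i \<ge> d" by (auto simp: not_le intro: less_imp_le)
      then have m: "m = single i d + (m - single i d)"
        by (intro poly_mapping_eqI) (auto simp: lookup_add lookup_minus lookup_single when_def)
      then have "mdeg m = d + mdeg (m - single i d)"
        by (metis mdeg_add mdeg_single)
      then have "Fract (monomial (m - single i d)) (F ^ n) \<in> M"
        using Suc.prems by (intro Suc.IH) simp
      moreover have "Fract (monomial (single i d)) F \<in> A"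
        by (intro A_invariant pure_power_invariant)
      ultimately have "Fract (monomial (single i d)) F * Fract (monomial (m - single i d)) (F ^ n) \<in> M"
        by (intro M_mult)
      moreover have "(monomial (single i d) :: 'a pol3) * monomial (m - single i d) = monomial m"
        using m by (simp add: monomial_mult)
      ultimately show ?thesis by simp
    qed
  qed
  have "x \<in> M" if x: "x \<in> preimage_chart_ring d F" for x
  proof -
    obtain P n where P: "P \<in> forms (n * d)" "x = Fract P (F ^ n)"
      using x by (auto simp: preimage_chart_ring_def)
    have "Fract (\<Sum>m\<in>T. scl (lookup P m) (monomial m)) (F ^ n) \<in> M" if "finite T" "T \<subseteq> keys P" for T
      using that
    proof (induction T rule: finite_induct)
      case empty
      show ?case using M_0 by (simp add: fract_collapse)
    next
      case (insert m T)
      have "Fract (Const (lookup P m)) 1 * Fract (monomial m) (F ^ n) \<in> M"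
        using insert.prems P(1) by (intro M_mult A_Const M_monomial) (auto simp: forms_def)
      then have "Fract (scl (lookup P m) (monomial m)) (F ^ n) \<in> M"
        by (simp add: scl_def)
      moreover have "Fract (\<Sum>m\<in>T. scl (lookup P m) (monomial m)) (F ^ n) \<in> M"
        using insert by blast
      ultimately show ?case
        unfolding sum.insert[OF insert.hyps(1,2)] Fract_add_same[OF power_not_zero[OF F(2)]]
        by (rule M_add)
    qed
    from this[OF finite_keys order_refl] show ?thesis
      by (simp only: P(2) monomial_expansion[symmetric])
  qed
  \<comment> \<open>The condition \<open>d dvd mdeg m\<close> in \<open>R\<close> makes
    \<open>mdeg m div d\<close> exact, so these quotients have degree zero.\<close>
  moreover have "S \<subseteq> preimage_chart_ring d F"
  proof
    fix s assume "s \<in> S"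
    then obtain m where m: "m \<in> R" "s = Fract (monomial m) (F ^ (mdeg m div d))"
      by (auto simp: S_def)
    then have "monomial m \<in> (forms (mdeg m div d * d) :: 'a pol3 set)"
      by (simp add: R_def monomial_def)
    then show "s \<in> preimage_chart_ring d F"
      unfolding preimage_chart_ring_def m(2) by blast
  qed
  ultimately show ?thesis
    unfolding finite_over_def A_def[symmetric] M_def using finS by blast
qed

lemma is_covering: "is_covering d Fs"
  unfolding is_covering_def
proof (intro conjI ballI impI)
  show "set Fs \<subseteq> forms d" by (rule Fs_forms)
  show "phi Fs \<in> P2 \<rightarrow> proj_space {..<length Fs}"
  proof
    fix p :: "(3 \<Rightarrow> 'a) set" assume "p \<in> P2"
    then obtain u where u: "p = proj_pt u" "u \<noteq> (\<lambda>_. 0)" by (rule P2_cases)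
    then have "values_at Fs u \<noteq> (\<lambda>_. 0)" "\<forall>j. j \<notin> {..<length Fs} \<longrightarrow> values_at Fs u j = 0"
      by (auto simp: values_at_nonzero) (simp add: values_at_def)
    then show "phi Fs p \<in> proj_space {..<length Fs}"
      unfolding u phi_proj_pt proj_space_def by blast
  qed
qed (rule finite_over_chart)

end

section \<open>Deck transformations\<close>

lemma rot_image_proj_pt: "rot e a b c ` proj_pt u = proj_pt (rot e a b c u)"
proof -
  have proj_pt_image: "proj_pt v = (\<lambda>t i. t * v i) ` {t. t \<noteq> 0}" for v :: "3 \<Rightarrow> 'a"
    unfolding proj_pt_def by blast
  show ?thesis
    unfolding proj_pt_image image_image rot_scale ..
qed

lemma Var_nonzero: "Var i \<noteq> (0 :: ('v, 'k::comm_ring_1) mpol)"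
  by (metis Var_def keys_single keys_zero insert_not_empty zero_neq_one)

text \<open>The gcd condition says that the matrix has order exactly \<open>d\<close> modulo
  scalars. The ordering of the weights makes the natural number subtractions true
  differences.\<close>

locale faithful_generating_forms = generating_forms +
  assumes weights_le: "a \<le> b" "b \<le> c"
    and weights_gcd: "gcd (b - a) (gcd (c - a) d) = 1"
begin

text \<open>The restriction to \<open>P2\<close> makes the map extensional, as membership in
  \<open>Bij\<close> requires; a point is a set of vectors, so the image of that set is again a
  point.\<close>

definition deck_map :: "nat \<Rightarrow> (3 \<Rightarrow> 'a) set \<Rightarrow> (3 \<Rightarrow> 'a) set" where
  "deck_map k = (\<lambda>p\<in>P2. rot (e ^ k) a b c ` p)"

lemma rot_nonzero: "u \<noteq> (\<lambda>_. 0) \<Longrightarrow> rot (e ^ k) a b c u \<noteq> (\<lambda>_. 0)"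
  using root_nonzero by (auto simp: rot_def fun_eq_iff)

lemma deck_map_proj_pt: "u \<noteq> (\<lambda>_. 0) \<Longrightarrow> deck_map k (proj_pt u) = proj_pt (rot (e ^ k) a b c u)"
  by (simp add: deck_map_def proj_pt_in_P2_iff rot_image_proj_pt)

lemma deck_map_in_P2: "p \<in> P2 \<Longrightarrow> deck_map k p \<in> P2"
  by (erule P2_cases) (simp add: deck_map_proj_pt proj_pt_in_P2_iff rot_nonzero)

lemma deck_map_add: "p \<in> P2 \<Longrightarrow> deck_map k (deck_map l p) = deck_map (k + l) p"
  by (erule P2_cases) (simp add: deck_map_proj_pt rot_nonzero rot_rot power_add)

lemma deck_map_mod: "deck_map (k mod d) = deck_map k"
  by (simp add: deck_map_def root_power_mod)

lemma deck_map_multiple: "d dvd k \<Longrightarrow> p \<in> P2 \<Longrightarrow> deck_map k p = p"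
  by (erule P2_cases) (simp add: deck_map_proj_pt root_power_eq_1_iff[THEN iffD2])

lemma compose_deck_map: "compose P2 (deck_map k) (deck_map l) = deck_map (k + l)"
proof (rule extensionalityI)
  show "deck_map (k + l) \<in> extensional P2" by (simp add: deck_map_def)
qed (simp_all add: compose_eq deck_map_add)

text \<open>A representative of \<open>-k\<close> modulo \<open>d\<close> for every
  \<open>k\<close>, since \<open>k + k * (d - 1) = k * d\<close>.\<close>

definition inv_exponent :: "nat \<Rightarrow> nat" where
  "inv_exponent k = k * (d - 1)"

lemma deck_map_inverse:
  assumes "p \<in> P2"
  shows "deck_map k (deck_map (inv_exponent k) p) = p" "deck_map (inv_exponent k) (deck_map k p) = p"
proof -
  have "k + inv_exponent k = k * d"
    unfolding inv_exponent_def using d_ge_3 by (cases d) auto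
  then show "deck_map k (deck_map (inv_exponent k) p) = p" "deck_map (inv_exponent k) (deck_map k p) = p"
    using assms by (simp_all add: deck_map_add deck_map_multiple add.commute)
qed

lemma deck_map_Bij: "deck_map k \<in> Bij P2"
proof -
  have "bij_betw (deck_map k) P2 P2"
    by (rule bij_betw_byWitness[where f' = "deck_map (inv_exponent k)"])
      (auto simp: deck_map_inverse deck_map_in_P2)
  then show ?thesis
    by (simp add: Bij_def deck_map_def)
qed

lemma deck_map_regular: "regular_P2 (deck_map k)"
  unfolding regular_P2_def
proof (intro conjI ballI)
  show "deck_map k \<in> P2 \<rightarrow> P2" using deck_map_in_P2 by blast
  fix p :: "(3 \<Rightarrow> 'a) set" assume "p \<in> P2"
  then obtain w where w: "p = proj_pt w" "w \<noteq> (\<lambda>_. 0)" by (rule P2_cases)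
  define H :: "3 \<Rightarrow> 'a pol3" where "H i = Const ((e ^ k) ^ triple a b c i) * Var i" for i
  have eval_H: "evaluate u (H i) = rot (e ^ k) a b c u i" for u i
    by (simp add: H_def rot_def evaluate.subst_mult evaluate.subst_Const evaluate.subst_Var)
  have "\<exists>i. evaluate u (H i) \<noteq> 0" if u: "u \<in> p" for u
  proof -
    obtain t where "t \<noteq> 0" "u = (\<lambda>i. t * w i)"
      using u unfolding w(1) proj_pt_def by blast
    then have "u \<noteq> (\<lambda>_. 0)" using w(2) by (auto simp: fun_eq_iff)
    then show ?thesis using rot_nonzero[of u k] by (auto simp: eval_H)
  qed
  moreover have "deck_map k (proj_pt u) = proj_pt (\<lambda>i. evaluate u (H i))" if "proj_pt u \<in> P2" for u
    using that by (simp add: eval_H deck_map_proj_pt proj_pt_in_P2_iff)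
  moreover have "H i \<in> forms 1" for i
    unfolding H_def by (intro forms_Const_mult forms_Var)
  ultimately show "\<exists>n H. (\<forall>i. H i \<in> forms n) \<and> (\<forall>u\<in>p. \<exists>i. evaluate u (H i) \<noteq> 0) \<and>
      (\<forall>u. (\<exists>i. evaluate u (H i) \<noteq> 0) \<and> proj_pt u \<in> P2 \<longrightarrow>
        deck_map k (proj_pt u) = proj_pt (\<lambda>i. evaluate u (H i)))"
    by blast
qed

lemma deck_map_auts: "deck_map k \<in> auts_P2"
proof -
  have "restrict (inv_into P2 (deck_map k)) P2 = deck_map (inv_exponent k)"
  proof (rule extensionalityI[of _ P2])
    fix p :: "(3 \<Rightarrow> 'a) set" assume p: "p \<in> P2"
    have "inj_on (deck_map k) P2" using deck_map_Bij by (auto simp: Bij_def bij_betw_def)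
    then show "restrict (inv_into P2 (deck_map k)) P2 p = deck_map (inv_exponent k) p"
      using p by (simp add: inv_into_f_eq deck_map_in_P2 deck_map_inverse)
  qed (auto simp: deck_map_def)
  then show ?thesis
    unfolding auts_P2_def using deck_map_Bij deck_map_regular by simp
qed

lemma phi_deck_map: "p \<in> P2 \<Longrightarrow> phi Fs (deck_map k p) = phi Fs p"
  by (erule P2_cases) (simp add: deck_map_proj_pt phi_rot)

text \<open>Off the coordinate lines the stabilizer is trivial: if \<open>e ^ n\<close> has equal
  powers with exponents \<open>a\<close>, \<open>b\<close> and \<open>c\<close>, then
  \<open>d\<close> divides \<open>n * (b - a)\<close>, \<open>n * (c - a)\<close> and
  \<open>n * d\<close>, hence also \<open>n\<close>. On the coordinate lines points may have shorter
  orbits.\<close>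

lemma deck_map_inj_at:
  assumes "k < d" "l < d" and u: "\<And>i. u i \<noteq> 0"
    and eq: "deck_map k (proj_pt u) = deck_map l (proj_pt u)"
  shows "k = l"
proof -
  have main: "k = l" if "l \<le> k" "k < d" "deck_map k (proj_pt u) = deck_map l (proj_pt u)" for k l
  proof -
    have "u \<noteq> (\<lambda>_. 0)" using u by auto
    then have "proj_pt (rot (e ^ k) a b c u) = proj_pt (rot (e ^ l) a b c u)"
      using that(3) by (simp add: deck_map_proj_pt)
    then obtain t where "rot (e ^ k) a b c u = (\<lambda>i. t * rot (e ^ l) a b c u i)"
      by (rule proj_pt_eqD)
    then have "(e ^ k) ^ triple a b c i * u i = t * ((e ^ l) ^ triple a b c i * u i)" for i
      by (metis rot_def)
    then have t: "(e ^ k) ^ triple a b c i = t * (e ^ l) ^ triple a b c i" for i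
      using u[of i] by (metis mult.assoc mult_cancel_right)
    define n where "n = k - l"
    have "e ^ k = e ^ n * e ^ l"
      using that(1) by (simp add: n_def power_add[symmetric])
    then have n: "(e ^ n) ^ triple a b c i = t" for i
      using t[of i] root_nonzero by (simp add: power_mult_distrib)
    have dvd: "d dvd n * (x - a)" if "a \<le> x" "(e ^ n) ^ x = t" for x
    proof -
      have "(e ^ n) ^ a * (e ^ n) ^ (x - a) = (e ^ n) ^ x"
        unfolding power_add[symmetric] using that(1) by simp
      also have "\<dots> = (e ^ n) ^ a * 1"
        using that(2) n[of 1] by simp
      finally have "(e ^ n) ^ a * (e ^ n) ^ (x - a) = (e ^ n) ^ a * 1" .
      then have "(e ^ n) ^ (x - a) = 1"
        using root_nonzero by (simp only: mult_cancel_left) simp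
      then show ?thesis
        by (simp add: power_mult[symmetric] root_power_eq_1_iff)
    qed
    have "d dvd n * (b - a)" "d dvd n * (c - a)"
      using dvd[of b] dvd[of c] n[of 2] n[of 3] weights_le by auto
    then have "d dvd gcd (n * (b - a)) (gcd (n * (c - a)) (n * d))"
      by simp
    also have "\<dots> = n * gcd (b - a) (gcd (c - a) d)"
      by (simp add: gcd_mult_distrib_nat)
    finally have "d dvd n" using weights_gcd by simp
    moreover have "n < d" using that(2) by (simp add: n_def)
    ultimately have "n = 0" using nat_dvd_not_less by blast
    then show "k = l" using that(1) by (simp add: n_def)
  qed
  show ?thesis
    using main[of l k] main[of k l] assms by (cases "l \<le> k") auto
qed

lemma deck_transformation_locally_deck_map:
  assumes \<sigma>: "\<And>p. p \<in> P2 \<Longrightarrow> \<sigma> p \<in> P2 \<and> phi Fs (\<sigma> p) = phi Fs p"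
    and H: "H i0 \<noteq> (0 :: 'a pol3)"
      "\<And>u. \<exists>i. evaluate u (H i) \<noteq> 0 \<Longrightarrow> u \<noteq> (\<lambda>_. 0) \<Longrightarrow> \<sigma> (proj_pt u) = proj_pt (\<lambda>i. evaluate u (H i))"
  obtains k where "k < d"
    "\<And>u. \<exists>i. evaluate u (H i) \<noteq> 0 \<Longrightarrow> u \<noteq> (\<lambda>_. 0) \<Longrightarrow> \<sigma> (proj_pt u) = deck_map k (proj_pt u)"
proof -
  text \<open>Every point satisfies, for some \<open>k\<close>, all equations \<open>minor k i j = 0\<close>.  As finitely many
    proper closed sets do not cover the plane, these hold identically for one \<open>k\<close>.\<close>
  define minor where "minor k i j = H i * (Const ((e ^ k) ^ triple a b c j) * Var j)
    - H j * (Const ((e ^ k) ^ triple a b c i) * Var i)" for k i j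
  have eval_minor: "evaluate u (minor k i j) =
      evaluate u (H i) * rot (e ^ k) a b c u j - evaluate u (H j) * rot (e ^ k) a b c u i" for u k i j
  proof -
    have "evaluate u (minor k i j) + evaluate u (H j * (Const ((e ^ k) ^ triple a b c i) * Var i))
        = evaluate u (H i * (Const ((e ^ k) ^ triple a b c j) * Var j))"
      unfolding evaluate.subst_add[symmetric] by (simp add: minor_def)
    then show ?thesis
      by (simp add: rot_def evaluate.subst_mult evaluate.subst_Const evaluate.subst_Var algebra_simps)
  qed
  have "\<exists>k<d. \<forall>i j. minor k i j = 0"
  proof (rule ccontr)
    assume "\<not> (\<exists>k<d. \<forall>i j. minor k i j = 0)"
    then have "\<forall>k. \<exists>i j. k < d \<longrightarrow> minor k i j \<noteq> 0" by blast
    then obtain i j where ij: "\<And>k. k < d \<Longrightarrow> minor k (i k) (j k) \<noteq> 0"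
      by metis
    \<comment> \<open>The factor \<open>H i0\<close> puts the point where \<open>H\<close>
      represents \<open>\<sigma>\<close>, and \<open>Var 1\<close> keeps it away from the
      origin.\<close>
    have "(\<Prod>k<d. minor k (i k) (j k)) * (H i0 * Var 1) \<noteq> 0"
      using ij H(1) by (simp add: Var_nonzero)
    then obtain u where "evaluate u ((\<Prod>k<d. minor k (i k) (j k)) * (H i0 * Var 1)) \<noteq> 0"
      by (rule nonvanishing_point)
    then have u: "evaluate u (H i0) \<noteq> 0" "u 1 \<noteq> 0" "\<And>k. k < d \<Longrightarrow> evaluate u (minor k (i k) (j k)) \<noteq> 0"
      by (auto simp: evaluate.subst_mult evaluate.subst_prod evaluate.subst_Var)
    then have u0: "u \<noteq> (\<lambda>_. 0)" by auto
    then have "\<sigma> (proj_pt u) \<in> P2" "phi Fs (\<sigma> (proj_pt u)) = phi Fs (proj_pt u)"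
      using \<sigma>[of "proj_pt u"] by (auto simp: proj_pt_in_P2_iff)
    moreover have eq: "\<sigma> (proj_pt u) = proj_pt (\<lambda>i. evaluate u (H i))"
      using H(2) u(1) u0 by blast
    ultimately obtain k where k: "k < d" "proj_pt (\<lambda>i. evaluate u (H i)) = proj_pt (rot (e ^ k) a b c u)"
      using phi_eq_orbit[OF u0, of "\<lambda>i. evaluate u (H i)"] proj_pt_in_P2_iff by metis
    from k(2) obtain t where "(\<lambda>i. evaluate u (H i)) = (\<lambda>i. t * rot (e ^ k) a b c u i)"
      by (rule proj_pt_eqD)
    then have "evaluate u (H i) = t * rot (e ^ k) a b c u i" for i
      by metis
    then have "evaluate u (minor k (i k) (j k)) = 0"
      by (simp add: eval_minor)
    then show False using u(3)[OF k(1)] by simp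
  qed
  then obtain k where k: "k < d" "\<And>i j. minor k i j = 0" by blast
  show ?thesis
  proof (rule that[OF k(1)])
    fix u assume u: "\<exists>i. evaluate u (H i) \<noteq> 0" "u \<noteq> (\<lambda>_. 0)"
    have "evaluate u (H i) * rot (e ^ k) a b c u j = evaluate u (H j) * rot (e ^ k) a b c u i" for i j
      using eval_minor[of u k i j] by (simp add: k(2))
    then have "proj_pt (\<lambda>i. evaluate u (H i)) = proj_pt (rot (e ^ k) a b c u)"
      using u rot_nonzero by (intro proj_pt_eqI) (auto simp: fun_eq_iff)
    then show "\<sigma> (proj_pt u) = deck_map k (proj_pt u)"
      using H(2) u by (simp add: deck_map_proj_pt)
  qed
qed

text \<open>A regular map is given by forms only locally, so the exponent could depend on the point.
  Any two of the open patches meet off the coordinate lines, where the value of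
  \<open>\<sigma>\<close> determines the exponent; the one found near (1 : 1 : 1) therefore holds
  everywhere.\<close>

lemma deck_transformation_is_deck_map:
  assumes "\<sigma> \<in> auts_P2" and phi: "\<And>p. p \<in> P2 \<Longrightarrow> phi Fs (\<sigma> p) = phi Fs p"
  obtains k where "k < d" "\<sigma> = deck_map k"
proof -
  have reg: "regular_P2 \<sigma>" and ext: "\<sigma> \<in> extensional P2"
    using assms(1) by (auto simp: auts_P2_def Bij_def)
  have \<sigma>: "\<sigma> p \<in> P2 \<and> phi Fs (\<sigma> p) = phi Fs p" if "p \<in> P2" for p
    using reg phi that by (auto simp: regular_P2_def)
  have patch: "\<exists>G k. G \<noteq> (0 :: 'a pol3) \<and> k < d \<and> \<sigma> p = deck_map k p \<and>
      (\<forall>u. u \<noteq> (\<lambda>_. 0) \<longrightarrow> evaluate u G \<noteq> 0 \<longrightarrow> \<sigma> (proj_pt u) = deck_map k (proj_pt u))"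
    if "p \<in> P2" for p
  proof -
    obtain w where w: "p = proj_pt w" "w \<noteq> (\<lambda>_. 0)" using \<open>p \<in> P2\<close> by (rule P2_cases)
    obtain n and H :: "3 \<Rightarrow> 'a pol3" where H: "\<forall>u\<in>p. \<exists>i. evaluate u (H i) \<noteq> 0"
      "\<forall>u. (\<exists>i. evaluate u (H i) \<noteq> 0) \<and> proj_pt u \<in> P2 \<longrightarrow> \<sigma> (proj_pt u) = proj_pt (\<lambda>i. evaluate u (H i))"
      using reg \<open>p \<in> P2\<close> unfolding regular_P2_def by blast
    obtain i where i: "evaluate w (H i) \<noteq> 0"
      using H(1) w(1) proj_pt_mem by blast
    then have "H i \<noteq> 0" by auto
    moreover have "\<sigma> (proj_pt u) = proj_pt (\<lambda>i. evaluate u (H i))"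
      if "\<exists>i. evaluate u (H i) \<noteq> 0" "u \<noteq> (\<lambda>_. 0)" for u
      using H(2) that proj_pt_in_P2_iff by blast
    ultimately obtain k where "k < d"
      "\<And>u. \<exists>i. evaluate u (H i) \<noteq> 0 \<Longrightarrow> u \<noteq> (\<lambda>_. 0) \<Longrightarrow> \<sigma> (proj_pt u) = deck_map k (proj_pt u)"
      using deck_transformation_locally_deck_map[of \<sigma> H i] \<sigma> by blast
    then show ?thesis
      using \<open>H i \<noteq> 0\<close> i w by (intro exI[of _ "H i"] exI[of _ k]) blast
  qed
  have "proj_pt (\<lambda>_. 1 :: 'a) \<in> P2"
    by (simp add: proj_pt_in_P2_iff fun_eq_iff)
  from patch[OF this] obtain G0 k0 where 0: "G0 \<noteq> (0 :: 'a pol3)" "k0 < d"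
    "\<And>u. u \<noteq> (\<lambda>_. 0) \<Longrightarrow> evaluate u G0 \<noteq> 0 \<Longrightarrow> \<sigma> (proj_pt u) = deck_map k0 (proj_pt u)"
    by blast
  have "\<sigma> p = deck_map k0 p" if p: "p \<in> P2" for p
  proof -
    from patch[OF p] obtain G k where G: "G \<noteq> (0 :: 'a pol3)" "k < d" "\<sigma> p = deck_map k p"
      "\<And>u. u \<noteq> (\<lambda>_. 0) \<Longrightarrow> evaluate u G \<noteq> 0 \<Longrightarrow> \<sigma> (proj_pt u) = deck_map k (proj_pt u)"
      by blast
    have "G * G0 * (Var 1 * Var 2 * Var 3) \<noteq> 0"
      using 0(1) G(1) by (simp add: Var_nonzero)
    then obtain u where "evaluate u (G * G0 * (Var 1 * Var 2 * Var 3)) \<noteq> 0"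
      by (rule nonvanishing_point)
    then have u: "evaluate u G \<noteq> 0" "evaluate u G0 \<noteq> 0" "u 1 \<noteq> 0" "u 2 \<noteq> 0" "u 3 \<noteq> 0"
      by (auto simp: evaluate.subst_mult evaluate.subst_Var)
    then have u_nonzero: "u i \<noteq> 0" for i
      using exhaust_three[of i] by auto
    then have "u \<noteq> (\<lambda>_. 0)" by (auto simp: fun_eq_iff)
    then have "deck_map k (proj_pt u) = deck_map k0 (proj_pt u)"
      using 0(3) G(4) u by metis
    then have "k = k0"
      by (rule deck_map_inj_at[OF G(2) 0(2) u_nonzero])
    then show ?thesis using G(3) by simp
  qed
  then have "\<sigma> = deck_map k0"
    by (intro extensionalityI[OF ext]) (auto simp: deck_map_def)
  with 0(2) show ?thesis by (rule that)
qed

lemma carrier_deck_group: "carrier (deck_group Fs) = deck_map ` {..<d}"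
proof
  show "carrier (deck_group Fs) \<subseteq> deck_map ` {..<d}"
  proof
    fix \<sigma> assume "\<sigma> \<in> carrier (deck_group Fs)"
    then have "\<sigma> \<in> auts_P2" "\<And>p. p \<in> P2 \<Longrightarrow> phi Fs (\<sigma> p) = phi Fs p"
      by (auto simp: deck_group_def)
    then obtain k where "k < d" "\<sigma> = deck_map k" by (rule deck_transformation_is_deck_map)
    then show "\<sigma> \<in> deck_map ` {..<d}" by blast
  qed
  show "deck_map ` {..<d} \<subseteq> carrier (deck_group Fs)"
    using deck_map_auts phi_deck_map by (auto simp: deck_group_def)
qed

lemma galois_covering: "galois_covering d Fs"
  unfolding galois_covering_def
proof (intro conjI ballI impI)
  show "is_covering d Fs" by (rule is_covering)
  fix p q :: "(3 \<Rightarrow> 'a) set"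
  assume "p \<in> P2" "q \<in> P2" and eq: "phi Fs p = phi Fs q"
  then obtain u v where uv: "p = proj_pt u" "u \<noteq> (\<lambda>_. 0)" "q = proj_pt v" "v \<noteq> (\<lambda>_. 0)"
    by (metis P2_cases)
  then obtain k where "k < d" "q = proj_pt (rot (e ^ k) a b c u)"
    using phi_eq_orbit[of u v] eq by metis
  then show "\<exists>\<sigma>\<in>carrier (deck_group Fs). \<sigma> p = q"
    unfolding carrier_deck_group using uv by (auto simp: deck_map_proj_pt)
qed

lemma deck_group_cyclic: "deck_group Fs \<cong> integer_mod_group d"
proof -
  let ?h = "\<lambda>n :: int. deck_map (nat n)"
  have carrier: "carrier (integer_mod_group d) = {0..<int d}"
    using d_ge_3 by (simp add: carrier_integer_mod_group)
  have "?h \<in> hom (integer_mod_group d) (deck_group Fs)"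
  proof (rule homI)
    fix m n assume "m \<in> carrier (integer_mod_group d)" "n \<in> carrier (integer_mod_group d)"
    then have mn: "0 \<le> m" "m < int d" "0 \<le> n" "n < int d" by (simp_all add: carrier)
    show "?h m \<in> carrier (deck_group Fs)"
      using mn by (simp add: carrier_deck_group)
    have "nat ((m + n) mod int d) = (nat m + nat n) mod d"
      using mn by (simp add: nat_mod_distrib nat_add_distrib)
    then show "?h (m \<otimes>\<^bsub>integer_mod_group d\<^esub> n) = ?h m \<otimes>\<^bsub>deck_group Fs\<^esub> ?h n"
      by (simp add: deck_group_def BijGroup_def deck_map_Bij compose_deck_map deck_map_mod)
  qed
  moreover have "bij_betw ?h (carrier (integer_mod_group d)) (carrier (deck_group Fs))"
  proof (rule bij_betw_imageI)
    show "inj_on ?h (carrier (integer_mod_group d))"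
    proof (rule inj_onI)
      fix m n assume mn: "m \<in> carrier (integer_mod_group d)" "n \<in> carrier (integer_mod_group d)"
        and "?h m = ?h n"
      then have "nat m = nat n"
        \<comment> \<open>The point (1 : 1 : 1) has no zero coordinate, so its images tell the
          exponents apart.\<close>
        by (intro deck_map_inj_at[of _ _ "\<lambda>_. 1"]) (auto simp: carrier)
      then show "m = n" using mn by (simp add: carrier eq_nat_nat_iff)
    qed
    have "deck_map ` {..<d} = ?h ` {0..<int d}"
    proof (intro equalityI image_subsetI)
      fix k assume "k \<in> {..<d}"
      then show "deck_map k \<in> ?h ` {0..<int d}" by (intro image_eqI[of _ _ "int k"]) auto
    qed auto
    then show "?h ` carrier (integer_mod_group d) = carrier (deck_group Fs)"
      by (simp add: carrier carrier_deck_group)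
  qed
  ultimately have "integer_mod_group d \<cong> deck_group Fs"
    by (auto simp: is_iso_def iso_def)
  then show ?thesis
    \<comment> \<open>The isomorphism is inverted from the cyclic side, which is known to be a
      group.\<close>
    by (rule group.iso_sym[OF group_integer_mod_group])
qed

end

theorem proposition3p2:
  fixes d a b c :: nat
    and e :: "'k :: {alg_closed_field, field_char_0}"
    and I :: "'k pol3 set"
  assumes "d \<ge> 3"
    and "primitive_root_of_1 d e"
    and "a \<le> b" and "b \<le> c" and "c \<le> d - 1"
    and "Gcd {a, b, c, d} = 1"
    and "I = ideal_of (invariant_monomials d e a b c)"
    and "min_gens I \<le> d + 1"
  shows "GT_system d I \<and> fails_WLP_from I (d - 1)"
proof -
  interpret diagonal_action d a b c e
    by unfold_locales fact+
  have I: "I = ideal_of (monomial ` invariant_exponents d a b c)"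
    using assms(7) by (simp add: invariant_monomials_eq)
  have card: "card (invariant_exponents d a b c) \<le> d + 1"
    using card_E_le assms(8) unfolding I by (rule le_trans)
  \<comment> \<open>Otherwise there would be at least \<open>d + 2\<close> invariant monomials: the
    bound on generators forces the group to act faithfully on the plane.\<close>
  then have gcd: "gcd (b - a) (gcd (c - a) d) = 1"
    using card_invariant_exponents_gcd[of d a b c] assms(1,3,4) by force
  have WLP: "fails_WLP_from I (d - 1)"
    unfolding I by (rule fails_WLP[OF card])
  have "togliatti_system d I"
    unfolding togliatti_system_def using artinian_I E_forms assms(8) WLP I by blast
  moreover have "admissible d e a b c"
    using assms by (simp add: admissible_def)
  moreover have "I = ideal_of (invariant_forms d e a b c)"
    by (simp add: I ideal_of_invariant_forms)
  moreover have "galois_covering d Fs \<and> deck_group Fs \<cong> integer_mod_group d"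
    if "set Fs \<subseteq> forms d" "ideal_of (set Fs) = I" for Fs
  proof -
    interpret faithful_generating_forms d a b c e Fs
      by unfold_locales (use that I assms(3,4) gcd in auto)
    show ?thesis using galois_covering deck_group_cyclic by blast
  qed
  ultimately show ?thesis
    unfolding GT_system_def using WLP by blast
qed

end
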